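(* Let $\mathcal{K}_2$ be a kernel whose Fourier transform is positive (nonnegative) and different from zero almost everywhere, let $h>0$, and let $\sigma_{Y_1},\ldots,\sigma_{Y_K}>0$ be known scale factors (not depending on the sample). Let $\mathbf{Y}=(Y_1,\ldots,Y_K)$ be a real random vector, with any cumulative distribution function, such that $Y_1,\ldots,Y_K$ are not mutually independent. Let $\mathbf{Y}(n)=(Y_1(n),\ldots,Y_K(n))$, $n=1,2,\ldots$, be i.i.d. copies of $\mathbf{Y}$, and let $\widehat{Q}(Y_1,\ldots,Y_K)$ be the estimator of the quadratic dependence computed from $\mathbf{Y}(1),\ldots,\mathbf{Y}(N)$. Then $$\lim_{N\to+\infty}\widehat{Q}(Y_1,\ldots,Y_K)>0\quad\text{almost surely}.$$
   Context: Throughout, $\mathcal{K}_2(u)=\int\mathcal{K}(u+v)\mathcal{K}(v)\,dv$ for a real square summable function $\mathcal{K}$ on $\mathbb{R}$, so that the Fourier transform of $\mathcal{K}_2$ is the nonnegative summable even function $|\psi_{\mathcal{K}}|^2$, where $\psi_{\mathcal{K}}$ is the Fourier transform of $\mathcal{K}$. Set $\mathcal{K}_{2,h}(x)=\mathcal{K}_2(x/h)/h$. The estimator is $$\widehat{Q}(Y_1,\ldots,Y_K)=\frac12\left\{\widehat{E}\,\widehat{\pi}_{\mathbf{Y}}(\mathbf{Y})+\prod_{k=1}^{K}\widehat{E}\,\widehat{\pi}_{Y_k}(Y_k)-2\widehat{E}\prod_{k=1}^{K}\widehat{\pi}_{Y_k}(Y_k)\right\},$$ where $\widehat{E}\phi(\mathbf{Y})=\frac1N\sum_{n=1}^{N}\phi(\mathbf{Y}(n))$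 and $$\widehat{\pi}_{\mathbf{Y}}(\mathbf{y})=\frac1N\sum_{n=1}^{N}\prod_{i=1}^{K}\mathcal{K}_{2,h}\left(\frac{y_i-Y_i(n)}{\sigma_{Y_i}}\right),\qquad \widehat{\pi}_{Y_k}(y_k)=\frac1N\sum_{n=1}^{N}\mathcal{K}_{2,h}\left(\frac{y_k-Y_k(n)}{\sigma_{Y_k}}\right).$$ *)

theory Defs
  imports "HOL-Probability.Probability"
begin

definition schwartz :: "(real \<Rightarrow> complex) \<Rightarrow> bool" where
  "schwartz \<phi> \<longleftrightarrow>
     (\<exists>D :: nat \<Rightarrow> real \<Rightarrow> complex.
        D 0 = \<phi> \<and>
        (\<forall>n x. (D n has_vector_derivative D (Suc n) x) (at x)) \<and>
        (\<forall>m n. bounded (range (\<lambda>x. x ^ m *\<^sub>R D n x))))"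

definition fourier_integral :: "(real \<Rightarrow> complex) \<Rightarrow> real \<Rightarrow> complex" where
  "fourier_integral \<phi> x = (LINT t|lebesgue. exp (- \<i> * complex_of_real (t * x)) * \<phi> t)"

text \<open>
  The autocorrelation of a square integrable function is in general neither integrable nor
  square integrable, so its Fourier transform cannot be defined by the Fourier integral. The
  relation below says that the function \<open>F\<close> is the Fourier transform of the function \<open>f\<close> in the
  sense of tempered distributions. It agrees with the Fourier integral for integrable \<open>f\<close> and
  with the Plancherel transform for square integrable \<open>f\<close>, and it determines \<open>F\<close> up to a null
  set. The integrability clauses are needed because a Bochner integral that does not exist is 0.
\<close>

definition is_fourier_transform :: "(real \<Rightarrow> complex) \<Rightarrow> (real \<Rightarrow> complex) \<Rightarrow> bool" where
  "is_fourier_transform f F \<longleftrightarrow>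
     f \<in> borel_measurable lebesgue \<and> F \<in> borel_measurable lebesgue \<and>
     (\<forall>\<phi>. schwartz \<phi> \<longrightarrow>
        integrable lebesgue (\<lambda>x. f x * fourier_integral \<phi> x) \<and>
        integrable lebesgue (\<lambda>t. F t * \<phi> t) \<and>
        (LINT x|lebesgue. f x * fourier_integral \<phi> x) = (LINT t|lebesgue. F t * \<phi> t))"

definition square_summable :: "(real \<Rightarrow> real) \<Rightarrow> bool" where
  "square_summable f \<longleftrightarrow>
     f \<in> borel_measurable lebesgue \<and> integrable lebesgue (\<lambda>v. (f v)\<^sup>2)"

definition autocorr :: "(real \<Rightarrow> real) \<Rightarrow> real \<Rightarrow> real" where
  "autocorr K u = (LINT v|lebesgue. K (u + v) * K v)"

definition rescale :: "real \<Rightarrow> (real \<Rightarrow> real) \<Rightarrow> real \<Rightarrow> real" where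
  "rescale h \<kappa> x = \<kappa> (x / h) / h"

text \<open>
  A sample is a sequence \<open>y\<close> of vectors of which \<open>y 1, \<dots>, y N\<close> are used. The argument \<open>\<kappa>\<close> below
  stands for the rescaled kernel.
\<close>

definition emp_mean :: "nat \<Rightarrow> (nat \<Rightarrow> 'b) \<Rightarrow> ('b \<Rightarrow> real) \<Rightarrow> real" where
  "emp_mean N y \<phi> = (1 / real N) * (\<Sum>n=1..N. \<phi> (y n))"

definition pi_joint ::
  "(real \<Rightarrow> real) \<Rightarrow> ('k::finite \<Rightarrow> real) \<Rightarrow> nat \<Rightarrow> (nat \<Rightarrow> real ^ 'k) \<Rightarrow> real ^ 'k \<Rightarrow> real" where
  "pi_joint \<kappa> \<sigma> N y z = (1 / real N) * (\<Sum>n=1..N. \<Prod>i\<in>UNIV. \<kappa> ((z $ i - y n $ i) / \<sigma> i))"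

definition pi_marginal ::
  "(real \<Rightarrow> real) \<Rightarrow> ('k::finite \<Rightarrow> real) \<Rightarrow> nat \<Rightarrow> (nat \<Rightarrow> real ^ 'k) \<Rightarrow> 'k \<Rightarrow> real \<Rightarrow> real" where
  "pi_marginal \<kappa> \<sigma> N y k x = (1 / real N) * (\<Sum>n=1..N. \<kappa> ((x - y n $ k) / \<sigma> k))"

definition Q_hat ::
  "(real \<Rightarrow> real) \<Rightarrow> ('k::finite \<Rightarrow> real) \<Rightarrow> nat \<Rightarrow> (nat \<Rightarrow> real ^ 'k) \<Rightarrow> real" where
  "Q_hat \<kappa> \<sigma> N y =
     (1 / 2) *
       (emp_mean N y (pi_joint \<kappa> \<sigma> N y)
        + (\<Prod>k\<in>UNIV. emp_mean N y (\<lambda>z. pi_marginal \<kappa> \<sigma> N y k (z $ k)))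
        - 2 * emp_mean N y (\<lambda>z. \<Prod>k\<in>UNIV. pi_marginal \<kappa> \<sigma> N y k (z $ k)))"

end

theory Submission
  imports Defs
begin

text \<open>
  By Fourier inversion, which the Gaussian test functions provide because \<open>autocorr K\<close> is
  continuous and bounded, the nonnegativity of \<open>\<Psi>\<close> makes the kernel a positive multiple \<open>a\<close> of
  the characteristic function of a probability \<open>\<nu>\<close> with almost everywhere positive density.
  Inserting this integral into the estimator gives
  \<open>a ^ CARD('k) / 2 * (\<integral>t. (norm (\<phi>\<^sub>N t - (\<Prod>k. \<phi>\<^sub>N\<^sub>k (t k))))\<^sup>2 \<partial>(PiM UNIV (\<lambda>_. \<nu>)))\<close> with the joint and marginal
  empirical characteristic functions \<open>\<phi>\<^sub>N\<close> and \<open>\<phi>\<^sub>N\<^sub>k\<close>. For each \<open>t\<close> these converge almost surely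
  by the strong law; Fubini exchanges the two null sets, and dominated convergence
  yields the limit, in which the true characteristic functions appear. If it were 0, the joint
  characteristic function would factorise almost everywhere, hence everywhere by continuity,
  and the components would be independent.
\<close>

section \<open>A strong law of large numbers for bounded variables\<close>

text \<open>The estimator is not an average of independent terms: the evaluation points are
  themselves sample points, and the cross term mixes K + 1 indices. The integral form removes this
  obstacle, because its integrand is a function of finitely many plain averages, to which the strong
  law applies. A second obstacle is that \<open>\<Psi>\<close> is known only through its pairings
  with test functions and is not assumed integrable, whereas a mixing probability needs finite mass;
  nonnegativity turns convergence of the Gaussian pairings into integrability by monotone
  convergence. The two hypotheses on \<open>\<Psi>\<close> have different tasks: the sign makes
  \<open>\<nu>\<close> a measure, and nonvanishing almost everywhere gives every interval positive
  \<open>\<nu>\<close>-mass, so that a gap between characteristic functions at a single frequency is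
  seen by the integral.\<close>

lemma LIMSEQ_iff_countable:
  fixes X :: "nat \<Rightarrow> real"
  shows "X \<longlonglongrightarrow> L \<longleftrightarrow> (\<forall>k. \<exists>n0. \<forall>n\<ge>n0. \<bar>X n - L\<bar> < inverse (real (Suc k)))"
proof
  assume "X \<longlonglongrightarrow> L"
  then show "\<forall>k. \<exists>n0. \<forall>n\<ge>n0. \<bar>X n - L\<bar> < inverse (real (Suc k))"
    unfolding LIMSEQ_def dist_real_def by simp
next
  assume *: "\<forall>k. \<exists>n0. \<forall>n\<ge>n0. \<bar>X n - L\<bar> < inverse (real (Suc k))"
  show "X \<longlonglongrightarrow> L"
    unfolding LIMSEQ_def dist_real_def
  proof (intro allI impI)
    fix e :: real assume "0 < e"
    then obtain k where "inverse (real (Suc k)) < e" using reals_Archimedean by blast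
    then show "\<exists>n0. \<forall>n\<ge>n0. \<bar>X n - L\<bar> < e" using *[rule_format, of k] by (meson less_trans)
  qed
qed

text \<open>Hoeffding's inequality bounds the probability of a deviation of at least \<epsilon> by a
  geometric sequence in the sample size. This is summable, so Borel-Cantelli leaves only finitely
  many such deviations almost surely.\<close>

lemma (in prob_space) strong_law_bounded:
  fixes X :: "nat \<Rightarrow> 'a \<Rightarrow> real"
  assumes indep: "indep_vars (\<lambda>_. borel) X {1..}"
    and bound: "\<And>n x. \<bar>X n x\<bar> \<le> B"
    and mean: "\<And>n. 1 \<le> n \<Longrightarrow> expectation (X n) = \<mu>"
  shows "AE x in M. (\<lambda>N. (1 / real N) * (\<Sum>n=1..N. X n x)) \<longlonglongrightarrow> \<mu>"
proof -
  \<comment> \<open>The added 1 keeps \<open>C\<close> positive when \<open>B = 0\<close>, since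
    \<open>C\<close> is divided by below.\<close>
  define C where "C = \<bar>B\<bar> + 1"
  have C: "C > 0" "\<And>n x. -C \<le> X n x \<and> X n x \<le> C"
    using bound by (auto simp: C_def abs_le_iff) (smt (verit) bound)+
  have rv [measurable]: "X n \<in> borel_measurable M" if "1 \<le> n" for n
    using indep that by (auto simp: indep_vars_def)
  have conv: "AE x in M. \<forall>\<^sub>F N in sequentially. \<bar>(1 / real N) * (\<Sum>n=1..N. X n x) - \<mu>\<bar> < \<epsilon>"
    if eps: "\<epsilon> > 0" for \<epsilon> :: real
  proof -
    define A where "A N = {x\<in>space M. \<bar>(\<Sum>n=1..N. X n x) - (\<Sum>n=1..N. expectation (X n))\<bar> \<ge> \<epsilon> * real N}" for N
    have meas: "A N \<in> sets M" for N
    proof -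
      have [measurable]: "(\<lambda>x. \<Sum>n=1..N. X n x) \<in> borel_measurable M"
        by (intro borel_measurable_sum rv) auto
      show ?thesis unfolding A_def by measurable
    qed
    \<comment> \<open>Each term ranges over an interval of length \<open>2 * C\<close>, so the
      Hoeffding exponent \<open>-2 * (\<epsilon> * N)\<^sup>2 / (4 * N * C\<^sup>2)\<close> is
      linear in \<open>N\<close>. At \<open>N = 0\<close> the ranges sum to 0, but there the right
      side is 2 and bounds any probability.\<close>
    have hoeff: "prob (A N) \<le> 2 * exp (- \<epsilon>\<^sup>2 / (2 * C\<^sup>2)) ^ N" for N
    proof (cases "N = 0")
      case True
      then show ?thesis using prob_le_1[of "A N"] by (simp add: order_trans[OF prob_le_1])
    next
      case False
      interpret Hoeffding_ineq M "{1..N}" X "\<lambda>_. -C" "\<lambda>_. C" "\<Sum>n=1..N. expectation (X n)"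
        by unfold_locales (use C in \<open>auto intro!: indep_vars_subset[OF indep]\<close>)
      have "prob (A N) \<le> 2 * exp (-2 * (\<epsilon> * real N)\<^sup>2 / (\<Sum>i\<in>{1..N}. (C - - C)\<^sup>2))"
        unfolding A_def using eps C(1) False by (intro Hoeffding_ineq_abs_ge) auto
      also have "-2 * (\<epsilon> * real N)\<^sup>2 / (\<Sum>i\<in>{1..N}. (C - - C)\<^sup>2) = real N * (- \<epsilon>\<^sup>2 / (2 * C\<^sup>2))"
        using False C(1) by (simp add: field_simps power2_eq_square)
      finally show ?thesis by (simp only: exp_of_nat_mult)
    qed
    have "summable (\<lambda>N. 2 * exp (- \<epsilon>\<^sup>2 / (2 * C\<^sup>2)) ^ N)"
      using eps C(1) by (intro summable_mult summable_geometric) auto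
    then have "summable (\<lambda>N. prob (A N))"
      by (rule summable_comparison_test_ev[rotated]) (use hoeff in auto)
    then have "AE x in M. \<forall>\<^sub>F N in sequentially. x \<in> space M - A N"
      by (intro borel_cantelli_AE1) (auto simp: meas emeasure_eq_measure)
    then show ?thesis
    proof (rule AE_mp, intro AE_I2 impI)
      fix x assume x: "x \<in> space M" and ev: "\<forall>\<^sub>F N in sequentially. x \<in> space M - A N"
      show "\<forall>\<^sub>F N in sequentially. \<bar>(1 / real N) * (\<Sum>n=1..N. X n x) - \<mu>\<bar> < \<epsilon>"
        using ev eventually_gt_at_top[of 0]
      proof eventually_elim
        case (elim N)
        then have "\<bar>(\<Sum>n=1..N. X n x) - real N * \<mu>\<bar> < \<epsilon> * real N"
          using x by (auto simp: A_def mean)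
        moreover have "(1 / real N) * (\<Sum>n=1..N. X n x) - \<mu> = ((\<Sum>n=1..N. X n x) - real N * \<mu>) / real N"
          using elim by (simp add: field_simps)
        ultimately show ?case using elim by (simp add: field_simps)
      qed
    qed
  qed
  \<comment> \<open>Countably many tolerances suffice for convergence, so their null sets unite to
    one.\<close>
  have "AE x in M. \<forall>k. \<forall>\<^sub>F N in sequentially. \<bar>(1 / real N) * (\<Sum>n=1..N. X n x) - \<mu>\<bar> < inverse (real (Suc k))"
    by (subst AE_all_countable) (intro allI conv, simp)
  then show ?thesis unfolding LIMSEQ_iff_countable eventually_sequentially .
qed

text \<open>Real and imaginary parts are treated separately. The exceptional set depends on
  \<open>f\<close>, hence for exponentials on the frequency.\<close>

lemma (in prob_space) strong_law_bounded_complex: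
  fixes Z :: "nat \<Rightarrow> 'a \<Rightarrow> 'v::second_countable_topology" and f :: "'v \<Rightarrow> complex"
  assumes indep: "indep_vars (\<lambda>_. borel) Z {1..}"
    and f [measurable]: "f \<in> borel_measurable borel"
    and bound: "\<And>v. norm (f v) \<le> B"
    and law: "\<And>n. 1 \<le> n \<Longrightarrow> distr M borel (Z n) = D"
  shows "AE x in M. (\<lambda>N. (1 / of_nat N) * (\<Sum>n=1..N. f (Z n x))) \<longlonglongrightarrow> integral\<^sup>L D f"
proof -
  have rv [measurable]: "Z n \<in> borel_measurable M" if "1 \<le> n" for n
    using indep that by (auto simp: indep_vars_def)
  have D: "prob_space D" using law[of 1] prob_space_distr[OF rv[of 1]] by simp
  have sD [measurable_cong]: "sets D = sets borel" using law[of 1] by auto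
  interpret D: prob_space D by (rule D)
  have int: "integrable D f"
    by (rule D.integrable_const_bound[of _ B]) (use bound in auto)
  have ind: "indep_vars (\<lambda>_. borel) (\<lambda>n x. g (f (Z n x))) {1..}"
    if [measurable]: "g \<in> borel_measurable borel" for g :: "complex \<Rightarrow> real"
    by (rule indep_vars_compose2[OF indep]) simp
  have "AE x in M. (\<lambda>N. (1 / real N) * (\<Sum>n=1..N. Re (f (Z n x)))) \<longlonglongrightarrow> Re (integral\<^sup>L D f)"
  proof (rule strong_law_bounded[OF ind])
    show "\<bar>Re (f (Z n x))\<bar> \<le> B" for n x
      using abs_Re_le_cmod[of "f (Z n x)"] bound[of "Z n x"] by linarith
    show "expectation (\<lambda>x. Re (f (Z n x))) = Re (integral\<^sup>L D f)" if "1 \<le> n" for n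
      unfolding integral_Re[OF int, symmetric] unfolding law[OF that, symmetric]
      by (rule integral_distr[OF rv[OF that], symmetric]) measurable
  qed simp
  moreover have "AE x in M. (\<lambda>N. (1 / real N) * (\<Sum>n=1..N. Im (f (Z n x)))) \<longlonglongrightarrow> Im (integral\<^sup>L D f)"
  proof (rule strong_law_bounded[OF ind])
    show "\<bar>Im (f (Z n x))\<bar> \<le> B" for n x
      using abs_Im_le_cmod[of "f (Z n x)"] bound[of "Z n x"] by linarith
    show "expectation (\<lambda>x. Im (f (Z n x))) = Im (integral\<^sup>L D f)" if "1 \<le> n" for n
      unfolding integral_Im[OF int, symmetric] unfolding law[OF that, symmetric]
      by (rule integral_distr[OF rv[OF that], symmetric]) measurable
  qed simp
  ultimately show ?thesis
  proof eventually_elim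
    case (elim x)
    have "Re ((1 / of_nat N) * w) = (1 / real N) * Re w \<and> Im ((1 / of_nat N) * w) = (1 / real N) * Im w"
      for N and w :: complex
      by (simp add: Re_divide_of_nat Im_divide_of_nat)
    with elim show ?case by (simp add: tendsto_complex_iff)
  qed
qed

section \<open>Independence from factorising characteristic functions\<close>

lemma borel_measurable_cis [measurable]: "cis \<in> borel_measurable borel"
  by (intro borel_measurable_continuous_onI continuous_intros)

lemma borel_measurable_cnj [measurable]: "cnj \<in> borel_measurable borel"
  by (intro borel_measurable_continuous_onI continuous_intros)

lemma integral_indicator_complex:
  "(\<integral>x. indicator A x \<partial>M) = complex_of_real (measure M (A \<inter> space M))"
proof -
  have "(\<integral>x. indicator A x \<partial>M) = (\<integral>x. complex_of_real (indicator A x) \<partial>M)"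
    by (intro Bochner_Integration.integral_cong) (auto simp: indicator_def)
  then show ?thesis by (simp add: integral_complex_of_real)
qed

lemma (in prob_space) char_distr_cis:
  assumes [measurable]: "W \<in> borel_measurable M"
  shows "char (distr M borel W) t = expectation (\<lambda>x. cis (t * W x))"
  by (simp add: char_def integral_distr cis_conv_exp)

text \<open>A bounded real \<open>G\<close> gives a probability with density proportional to \<open>1 + G / 2\<close>,
  under which \<open>W\<close> has the same characteristic function as before.\<close>

lemma (in prob_space) expectation_indicator_of_char_real:
  fixes G W :: "'a \<Rightarrow> real"
  assumes [measurable]: "G \<in> borel_measurable M" "W \<in> borel_measurable M" "A \<in> sets borel"
    and bound: "\<And>x. \<bar>G x\<bar> \<le> 1"
    and char: "\<And>t. expectation (\<lambda>x. of_real (G x) * cis (t * W x))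
                 = of_real (expectation G) * expectation (\<lambda>x. cis (t * W x))"
  shows "expectation (\<lambda>x. G x * indicator A (W x)) = expectation G * expectation (\<lambda>x. indicator A (W x))"
proof -
  have int: "integrable M (\<lambda>x. G x * f x)" "integrable M f" if [measurable]: "f \<in> borel_measurable M" and "\<And>x. \<bar>f x\<bar> \<le> 1"
    for f :: "'a \<Rightarrow> real"
    using bound that(2)
    by (auto intro!: integrable_const_bound[of _ 1] AE_I2 mult_le_one simp: abs_mult)
  have intc: "integrable M (\<lambda>x. complex_of_real (G x) * f x)" "integrable M f"
    if [measurable]: "f \<in> borel_measurable M" and "\<And>x. norm (f x) \<le> 1" for f :: "'a \<Rightarrow> complex"
    using bound that(2)
    by (auto intro!: integrable_const_bound[of _ 1] AE_I2 mult_le_one simp: norm_mult)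
  have intG: "integrable M G" using int(1)[of "\<lambda>_. 1"] by simp
  \<comment> \<open>The weight 1/2 keeps the density away from 0 even where \<open>G\<close> is
    -1.\<close>
  have posG: "1 + G x / 2 > 0" for x using bound[of x] by (auto simp: abs_le_iff)
  define c where "c = 1 + expectation G / 2"
  have "\<bar>expectation G\<bar> \<le> 1"
    by (rule order_trans[OF integral_norm_bound[of M G, unfolded real_norm_def]])
       (use integral_mono[OF integrable_norm[OF intG], of "\<lambda>_. 1"] bound in \<open>simp add: prob_space\<close>)
  then have c: "c > 0" by (auto simp: c_def abs_le_iff)
  define f where "f x = (1 + G x / 2) / c" for x
  have f [measurable]: "f \<in> borel_measurable M" unfolding f_def by measurable
  have fpos: "f x \<ge> 0" for x using posG[of x] c by (simp add: f_def)
  define D where "D = density M (\<lambda>x. ennreal (f x))"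
  have intf: "expectation f = 1"
  proof -
    have "expectation f = (1 + expectation G / 2) / c"
      unfolding f_def using intG by (simp add: prob_space)
    then show ?thesis using c by (simp add: c_def)
  qed
  interpret D: prob_space D
  proof
    have "emeasure D (space D) = (\<integral>\<^sup>+x. ennreal (f x) \<partial>M)"
      by (simp add: D_def emeasure_density cong: nn_integral_cong)
    also have "\<dots> = ennreal (expectation f)"
      using intG fpos by (intro nn_integral_eq_integral) (auto simp: f_def)
    finally show "emeasure D (space D) = 1" by (simp add: intf)
  qed
  have [measurable]: "W \<in> borel_measurable D" by (simp add: D_def)
  \<comment> \<open>By \<open>char\<close> the perturbation multiplies the characteristic function
    of \<open>W\<close> by \<open>1 + expectation G / 2\<close>, which the normalisation
    \<open>c\<close> cancels.\<close>
  have "char (distr D borel W) t = char (distr M borel W) t" for t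
  proof -
    have "char (distr D borel W) t = (\<integral>x. f x *\<^sub>R cis (t * W x) \<partial>M)"
      using fpos by (simp add: D.char_distr_cis) (simp add: D_def integral_density)
    also have "\<dots> = (\<integral>x. (1 / of_real c) * (cis (t * W x) + (1/2) * (of_real (G x) * cis (t * W x))) \<partial>M)"
      by (intro Bochner_Integration.integral_cong) (auto simp: f_def scaleR_conv_of_real field_simps)
    also have "\<dots> = (1 / of_real c) * (expectation (\<lambda>x. cis (t * W x)) + (1/2) * expectation (\<lambda>x. of_real (G x) * cis (t * W x)))"
      by (subst integral_mult_right_zero, subst Bochner_Integration.integral_add)
         (auto intro!: intc simp: norm_mult order_trans[OF bound])
    also have "\<dots> = (1 / of_real c) * (1 + of_real (expectation G) / 2) * expectation (\<lambda>x. cis (t * W x))"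
      unfolding char by (simp add: algebra_simps)
    also have "(1 / of_real c) * (1 + of_real (expectation G) / 2) = (1 :: complex)"
    proof -
      have "(1 + of_real (expectation G) / 2) = complex_of_real c" by (simp add: c_def)
      then show ?thesis using c by simp
    qed
    finally show ?thesis by (simp add: char_distr_cis)
  qed
  then have law: "distr D borel W = distr M borel W"
    by (intro Levy_uniqueness D.real_distribution_distr real_distribution_distr ext) auto
  \<comment> \<open>Let p be the probability that \<open>W\<close> lies in \<open>A\<close> and q
    the expectation of \<open>G\<close> on that event. Equality of the two laws reads
    \<open>p = (p + q / 2) / c\<close>, which solves to
    \<open>q = expectation G * p\<close>.\<close>
  have ind: "expectation (\<lambda>x. indicator A (W x) :: real) = (\<integral>y. indicator A y \<partial>distr M borel W)"
    by (rule integral_distr[symmetric]) measurable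
  also have "\<dots> = (\<integral>x. indicator A (W x) \<partial>D)"
    unfolding law[symmetric] by (rule integral_distr) measurable
  also have "\<dots> = expectation (\<lambda>x. f x * indicator A (W x))"
    using fpos by (simp add: D_def integral_density)
  also have "\<dots> = expectation (\<lambda>x. (1/c) * (indicator A (W x) + (1/2) * (G x * indicator A (W x))))"
    by (intro Bochner_Integration.integral_cong) (auto simp: f_def field_simps)
  also have "\<dots> = (1/c) * (expectation (\<lambda>x. indicator A (W x)) + (1/2) * expectation (\<lambda>x. G x * indicator A (W x)))"
    by (subst integral_mult_right_zero, subst Bochner_Integration.integral_add)
       (auto intro!: int simp: indicator_def order_trans[OF bound])
  finally show ?thesis using c by (simp add: field_simps c_def)
qed

text \<open>The density argument needs a real \<open>G\<close>, so real and imaginary parts are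
  split off. Their factorisation also needs that of \<open>cnj G\<close>, which follows by
  conjugating the hypothesis at frequency \<open>- t\<close>.\<close>

lemma (in prob_space) expectation_indicator_of_char:
  fixes G :: "'a \<Rightarrow> complex" and W :: "'a \<Rightarrow> real"
  assumes [measurable]: "G \<in> borel_measurable M" "W \<in> borel_measurable M" "A \<in> sets borel"
    and bound: "\<And>x. norm (G x) \<le> 1"
    and char: "\<And>t. expectation (\<lambda>x. G x * cis (t * W x)) = expectation G * expectation (\<lambda>x. cis (t * W x))"
  shows "expectation (\<lambda>x. G x * indicator A (W x)) = expectation G * expectation (\<lambda>x. indicator A (W x))"
proof -
  have int: "integrable M (\<lambda>x. G x * f x)" "integrable M f"
    if [measurable]: "f \<in> borel_measurable M" and "\<And>x. norm (f x) \<le> 1" for f :: "'a \<Rightarrow> complex"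
    using bound that(2)
    by (auto intro!: integrable_const_bound[of _ 1] AE_I2 mult_le_one simp: norm_mult)
  have intG: "integrable M G" using int(1)[of "\<lambda>_. 1"] by simp
  have char': "expectation (\<lambda>x. cnj (G x) * cis (t * W x)) = cnj (expectation G) * expectation (\<lambda>x. cis (t * W x))" for t
  proof -
    have "expectation (\<lambda>x. cnj (G x) * cis (t * W x)) = cnj (expectation (\<lambda>x. G x * cis ((- t) * W x)))"
      by (subst Bochner_Integration.integral_cnj[symmetric], intro Bochner_Integration.integral_cong refl) (simp add: cis_cnj)
    also have "\<dots> = cnj (expectation G) * expectation (\<lambda>x. cis (t * W x))"
      unfolding char complex_cnj_mult by (simp only: Bochner_Integration.integral_cnj[symmetric] cis_cnj mult_minus_left minus_minus)
    finally show ?thesis .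
  qed
  have re: "expectation (\<lambda>x. Re (G x) * indicator A (W x)) = expectation (\<lambda>x. Re (G x)) * expectation (\<lambda>x. indicator A (W x))"
  proof (rule expectation_indicator_of_char_real)
    fix t
    have "expectation (\<lambda>x. of_real (Re (G x)) * cis (t * W x)) = expectation (\<lambda>x. (G x * cis (t * W x) + cnj (G x) * cis (t * W x)) / 2)"
      by (intro Bochner_Integration.integral_cong refl) (simp add: complex_eq_iff field_simps)
    also have "\<dots> = (expectation (\<lambda>x. G x * cis (t * W x)) + expectation (\<lambda>x. cnj (G x) * cis (t * W x))) / 2"
      using bound by (subst integral_divide_zero, subst Bochner_Integration.integral_add)
        (auto intro!: integrable_const_bound[of _ 1] simp: norm_mult)
    also have "\<dots> = of_real (expectation (\<lambda>x. Re (G x))) * expectation (\<lambda>x. cis (t * W x))"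
      unfolding char char' by (simp add: integral_Re[OF intG] complex_eq_iff field_simps)
    finally show "expectation (\<lambda>x. of_real (Re (G x)) * cis (t * W x)) = of_real (expectation (\<lambda>x. Re (G x))) * expectation (\<lambda>x. cis (t * W x))" .
  qed (measurable, rule order_trans[OF abs_Re_le_cmod bound])
  have im: "expectation (\<lambda>x. Im (G x) * indicator A (W x)) = expectation (\<lambda>x. Im (G x)) * expectation (\<lambda>x. indicator A (W x))"
  proof (rule expectation_indicator_of_char_real)
    fix t
    have "expectation (\<lambda>x. of_real (Im (G x)) * cis (t * W x)) = expectation (\<lambda>x. (G x * cis (t * W x) - cnj (G x) * cis (t * W x)) / (2 * \<i>))"
      by (intro Bochner_Integration.integral_cong refl) (simp add: complex_diff_cnj flip: left_diff_distrib, simp add: complex_eq_iff)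
    also have "\<dots> = (expectation (\<lambda>x. G x * cis (t * W x)) - expectation (\<lambda>x. cnj (G x) * cis (t * W x))) / (2 * \<i>)"
      using bound by (subst integral_divide_zero, subst Bochner_Integration.integral_diff)
        (auto intro!: integrable_const_bound[of _ 1] simp: norm_mult)
    also have "\<dots> = of_real (expectation (\<lambda>x. Im (G x))) * expectation (\<lambda>x. cis (t * W x))"
      unfolding char char'
      by (simp add: integral_Im[OF intG] complex_diff_cnj flip: left_diff_distrib, simp add: complex_eq_iff)
    finally show "expectation (\<lambda>x. of_real (Im (G x)) * cis (t * W x)) = of_real (expectation (\<lambda>x. Im (G x))) * expectation (\<lambda>x. cis (t * W x))" .
  qed (measurable, rule order_trans[OF abs_Im_le_cmod bound])
  have i: "integrable M (\<lambda>x. G x * indicator A (W x))" by (intro int) (auto simp: indicator_def)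
  have i2: "expectation (\<lambda>x. indicator A (W x) :: complex) = of_real (expectation (\<lambda>x. indicator A (W x)))"
    unfolding integral_complex_of_real[symmetric] by (intro Bochner_Integration.integral_cong) (auto simp: indicator_def)
  have *: "Re (indicator A y) = indicator A y" "Im (indicator A y) = 0" for y
    by (auto simp: indicator_def)
  show ?thesis
    using re im by (simp add: complex_eq_iff integral_Re[OF i, symmetric] integral_Im[OF i, symmetric] i2 * integral_Re[OF intG] integral_Im[OF intG])
qed

text \<open>Exponentials are exchanged for indicators one coordinate at a time, the remaining
  factors acting as the bounded \<open>G\<close> of the previous lemma. Thus only uniqueness of
  one-dimensional characteristic functions is invoked.\<close>

theorem (in prob_space) indep_vars_of_char:
  fixes X :: "'k::finite \<Rightarrow> 'a \<Rightarrow> real"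
  assumes rv [measurable]: "\<And>k. X k \<in> borel_measurable M"
    and char: "\<And>t. expectation (\<lambda>x. \<Prod>k\<in>UNIV. cis (t k * X k x)) = (\<Prod>k\<in>UNIV. expectation (\<lambda>x. cis (t k * X k x)))"
  shows "indep_vars (\<lambda>_. borel) X UNIV"
proof -
  have mixed: "expectation (\<lambda>x. (\<Prod>k\<in>J. indicator (A k) (X k x)) * (\<Prod>k\<in>-J. cis (t k * X k x)))
      = (\<Prod>k\<in>J. expectation (\<lambda>x. indicator (A k) (X k x))) * (\<Prod>k\<in>-J. expectation (\<lambda>x. cis (t k * X k x)))"
    if [measurable]: "\<And>k. A k \<in> sets borel" for J t and A :: "'k \<Rightarrow> real set"
    using finite[of J]
  proof (induction J arbitrary: t rule: finite_induct)
    case empty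
    then show ?case using char[of t] by simp
  next
    case (insert j J)
    define G where "G x = (\<Prod>k\<in>J. indicator (A k) (X k x)) * (\<Prod>k\<in>-insert j J. cis (t k * X k x))" for x
    define g where "g = (\<Prod>k\<in>J. expectation (\<lambda>x. indicator (A k) (X k x))) * (\<Prod>k\<in>-insert j J. expectation (\<lambda>x. cis (t k * X k x)))"
    have split: "- J = insert j (- insert j J)" "j \<notin> - insert j J" using insert.hyps by auto
    have prod_split: "(\<Prod>k\<in>-J. F k) = F j * (\<Prod>k\<in>-insert j J. F k)" for F :: "'k \<Rightarrow> complex"
      by (subst split(1), subst prod.insert) (use split(2) in auto)
    \<comment> \<open>The induction hypothesis is general in the frequencies: that of coordinate
      \<open>j\<close> runs freely over \<open>s\<close> while the others keep
      \<open>t\<close>.\<close>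
    have step: "expectation (\<lambda>x. G x * cis (s * X j x)) = g * expectation (\<lambda>x. cis (s * X j x))" for s
    proof -
      have eq: "(\<Prod>k\<in>-J. F k ((t(j := s)) k)) = F j s * (\<Prod>k\<in>-insert j J. F k (t k))" for F :: "'k \<Rightarrow> real \<Rightarrow> complex"
        unfolding prod_split by (auto intro!: prod.cong arg_cong[where f="\<lambda>z. _ * z"])
      show ?thesis
        using insert.IH[of "t(j := s)"] unfolding G_def g_def eq[of "\<lambda>k s. cis (s * X k _)"]
          eq[of "\<lambda>k s. expectation (\<lambda>x. cis (s * X k x))"] by (simp add: mult_ac)
    qed
    \<comment> \<open>Frequency 0 turns the exponential of coordinate \<open>j\<close> into
      1.\<close>
    have Gg: "expectation G = g" using step[of 0] by (simp add: prob_space)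
    have norm_ind: "norm (indicator B y :: complex) \<le> 1" for B and y :: real by (simp add: indicator_def)
    have Gm: "G \<in> borel_measurable M" unfolding G_def by measurable
    have "norm (G x) \<le> 1" for x
      unfolding G_def by (auto simp: norm_mult simp flip: prod_norm intro!: mult_le_one prod_le_1 prod_nonneg norm_ind)
    then have "expectation (\<lambda>x. G x * indicator (A j) (X j x)) = expectation G * expectation (\<lambda>x. indicator (A j) (X j x))"
      by (intro expectation_indicator_of_char) (auto simp: Gm step Gg)
    then show ?case
      unfolding Gg using insert.hyps by (simp add: G_def g_def mult_ac)
  qed
  show ?thesis
  proof (subst indep_vars_finite[where E="\<lambda>_. sets borel"], goal_cases)
    case 8
    have "prob (\<Inter>j\<in>UNIV. X j -` A j \<inter> space M) = (\<Prod>j\<in>UNIV. prob (X j -` A j \<inter> space M))"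
      if "\<forall>j\<in>UNIV. A j \<in> sets borel" for A
    proof -
      have [measurable]: "\<And>k. A k \<in> sets borel" using that by auto
      have p: "complex_of_real (prob (X j -` A j \<inter> space M)) = expectation (\<lambda>x. indicator (A j) (X j x))" for j
      proof -
        have "expectation (\<lambda>x. indicator (A j) (X j x)) = expectation (indicator (X j -` A j \<inter> space M) :: _ \<Rightarrow> complex)"
          by (intro Bochner_Integration.integral_cong) (auto simp: indicator_def)
        then show ?thesis by (simp add: integral_indicator_complex)
      qed
      have "expectation (\<lambda>x. \<Prod>k\<in>UNIV. indicator (A k) (X k x)) = expectation (indicator (\<Inter>j\<in>UNIV. X j -` A j \<inter> space M) :: _ \<Rightarrow> complex)"
        by (intro Bochner_Integration.integral_cong) (auto simp: indicator_def prod_zero_iff)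
      then have "complex_of_real (prob (\<Inter>j\<in>UNIV. X j -` A j \<inter> space M)) = of_real (\<Prod>j\<in>UNIV. prob (X j -` A j \<inter> space M))"
        using mixed[of A UNIV] by (simp add: p integral_indicator_complex)
      then show ?thesis by (simp only: of_real_eq_iff)
    qed
    then show ?case by (auto simp: Pi_iff)
  next
    case 3
    show ?case using sets.sigma_sets_eq[of borel] by metis
  qed (auto simp: Int_stable_def)
qed

section \<open>Continuity of the autocorrelation\<close>

text \<open>The exceptional set of \<open>P\<close> may fail to be Borel, so a Borel null set
  covering it is transported instead.\<close>

lemma AE_lborel_affine:
  fixes c :: real
  assumes "AE x in lborel. P x" "c \<noteq> 0"
  shows "AE x in lborel. P (t + c * x)"
proof -
  from assms(1) obtain N where N: "{x. \<not> P x} \<subseteq> N" "N \<in> null_sets lborel"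
    by (auto simp: eventually_ae_filter)
  then have "AE x in lborel. t + c * x \<notin> N"
    using assms(2) by (intro AE_borel_affine) (auto simp: AE_not_in)
  then show ?thesis by eventually_elim (use N in auto)
qed

section \<open>Mean square approximation by compactly supported continuous functions\<close>

definition clip :: "real \<Rightarrow> real \<Rightarrow> real" where "clip c y = max (-c) (min c y)"
text \<open>A cut-off equal to 1 for \<open>\<bar>x\<bar> \<le> c\<close> and to 0 for
  \<open>\<bar>x\<bar> \<ge> c + 1\<close>; a slope in place of a jump preserves the continuity of
  what it multiplies.\<close>

definition tent :: "real \<Rightarrow> real \<Rightarrow> real" where "tent c x = max 0 (min 1 (c + 1 - \<bar>x\<bar>))"

lemma continuous_on_clip [continuous_intros]: "continuous_on A f \<Longrightarrow> continuous_on A (\<lambda>x. clip c (f x))"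
  unfolding clip_def by (intro continuous_intros)

lemma continuous_on_tent [continuous_intros]: "continuous_on A f \<Longrightarrow> continuous_on A (\<lambda>x. tent c (f x))"
  unfolding tent_def by (intro continuous_intros)

lemma measurable_clip [measurable]: "clip c \<in> borel_measurable borel"
  by (intro borel_measurable_continuous_onI continuous_intros)

lemma measurable_tent [measurable]: "tent c \<in> borel_measurable borel"
  by (intro borel_measurable_continuous_onI continuous_intros)

lemma abs_clip_le: "0 \<le> c \<Longrightarrow> \<bar>clip c y\<bar> \<le> c" "0 \<le> c \<Longrightarrow> \<bar>clip c y\<bar> \<le> \<bar>y\<bar>"
  by (auto simp: clip_def)

lemma tent_bounds: "0 \<le> tent c x" "tent c x \<le> 1" by (auto simp: tent_def)

text \<open>Two dominated limits. Truncating values and support makes \<open>f\<close> bounded on a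
  bounded set at small cost. Continuous functions converging to \<open>f\<close> almost everywhere,
  truncated in the same way, then have a common integrable bound.\<close>

lemma L2_approx_continuous:
  fixes f :: "real \<Rightarrow> real"
  assumes [measurable]: "f \<in> borel_measurable borel"
    and int: "integrable lborel (\<lambda>x. (f x)\<^sup>2)" and "0 < \<eta>"
  obtains g R where "continuous_on UNIV g" "\<And>x. R < \<bar>x\<bar> \<Longrightarrow> g x = 0"
    "integrable lborel (\<lambda>x. (f x - g x)\<^sup>2)" "(\<integral>x. (f x - g x)\<^sup>2 \<partial>lborel) < \<eta>"
proof -
  define h where "h n x = clip (real n) (f x) * tent (real n) x" for n x
  have h [measurable]: "h n \<in> borel_measurable borel" for n unfolding h_def by measurable
  have h_le: "\<bar>h n x\<bar> \<le> \<bar>f x\<bar>" for n x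
    using mult_mono[OF abs_clip_le(2)[of "real n" "f x"] tent_bounds(2)[of "real n" x]] tent_bounds(1)[of "real n" x]
    by (simp add: h_def abs_mult)
  have fh_le: "(f x - h n x)\<^sup>2 \<le> 4 * (f x)\<^sup>2" for n x
  proof -
    have "\<bar>f x - h n x\<bar> \<le> 2 * \<bar>f x\<bar>" using h_le[of n x] by linarith
    then have "\<bar>f x - h n x\<bar>\<^sup>2 \<le> (2 * \<bar>f x\<bar>)\<^sup>2" by (rule power_mono) simp
    then show ?thesis by (simp add: power_mult_distrib)
  qed
  have "(\<lambda>n. \<integral>x. (f x - h n x)\<^sup>2 \<partial>lborel) \<longlonglongrightarrow> (\<integral>x. 0 \<partial>(lborel::real measure))"
  proof (rule integral_dominated_convergence[where w="\<lambda>x. 4 * (f x)\<^sup>2"])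
    show "AE x in lborel. (\<lambda>n. (f x - h n x)\<^sup>2) \<longlonglongrightarrow> 0"
    proof (rule AE_I2)
      fix x
      obtain m where m: "\<bar>f x\<bar> + \<bar>x\<bar> < real m" using reals_Archimedean2 by blast
      have "\<forall>\<^sub>F n in sequentially. (f x - h n x)\<^sup>2 = 0"
        using eventually_ge_at_top[of m]
      proof eventually_elim
        case (elim n)
        then have "real m \<le> real n" by simp
        then have "clip (real n) (f x) = f x" "tent (real n) x = 1"
          using m by (auto simp: clip_def tent_def)
        then show ?case by (simp add: h_def)
      qed
      then show "(\<lambda>n. (f x - h n x)\<^sup>2) \<longlonglongrightarrow> 0" by (rule tendsto_eventually)
    qed
  qed (use int fh_le in auto)
  \<comment> \<open>A quarter for each stage, because
    \<open>(x + y)\<^sup>2 \<le> 2 * x\<^sup>2 + 2 * y\<^sup>2\<close> doubles both errors.\<close>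
  then have "\<forall>\<^sub>F n in sequentially. (\<integral>x. (f x - h n x)\<^sup>2 \<partial>lborel) < \<eta> / 4"
    using \<open>0 < \<eta>\<close> by (intro order_tendstoD(2)) auto
  then obtain n where n: "(\<integral>x. (f x - h n x)\<^sup>2 \<partial>lborel) < \<eta> / 4"
    by (auto simp: eventually_sequentially)
  have int1: "integrable lborel (\<lambda>x. (f x - h n x)\<^sup>2)"
    using fh_le by (intro Bochner_Integration.integrable_bound[OF integrable_mult_right[of 4, OF int]]) auto
  have "f measurable_on UNIV"
    by (rule lebesgue_measurable_imp_measurable_on_real) (auto intro: measurable_completion)
  then obtain N k where N: "negligible N" and k: "\<And>m. continuous_on UNIV (k m)"
    and lim: "\<And>x. x \<notin> N \<Longrightarrow> (\<lambda>m. k m x) \<longlonglongrightarrow> f x"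
    unfolding measurable_on_def by auto
  have AE_N: "AE x in lborel. x \<notin> N"
    using AE_not_in[of N lebesgue] N by (simp add: negligible_iff_null_sets AE_completion_iff)
  define g where "g m x = clip (real n) (k m x) * tent (real n) x" for m x
  have g_cont: "continuous_on UNIV (g m)" for m
    unfolding g_def by (intro continuous_intros k)
  have [measurable]: "g m \<in> borel_measurable borel" for m
    by (rule borel_measurable_continuous_onI[OF g_cont])
  \<comment> \<open>Both truncated functions take values between \<open>- real n\<close> and
    \<open>real n\<close> and vanish beyond distance \<open>real n + 1\<close> from 0.\<close>
  define w where "w x = (2 * real n)\<^sup>2 * indicator {- real n - 1 .. real n + 1} x" for x :: real
  have w: "integrable lborel w" unfolding w_def by (intro integrable_mult_right) simp
  have hg_le: "(h n x - g m x)\<^sup>2 \<le> w x" for m x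
  proof (cases "\<bar>x\<bar> \<le> real n + 1")
    case True
    have "\<bar>h n x - g m x\<bar> = \<bar>clip (real n) (f x) - clip (real n) (k m x)\<bar> * tent (real n) x"
      by (simp add: h_def g_def abs_mult tent_bounds flip: left_diff_distrib)
    also have "\<dots> \<le> (2 * real n) * 1"
      using abs_clip_le(1)[of "real n" "f x"] abs_clip_le(1)[of "real n" "k m x"]
      by (intro mult_mono tent_bounds) auto
    finally have "\<bar>h n x - g m x\<bar>\<^sup>2 \<le> (2 * real n)\<^sup>2" by (intro power_mono) auto
    with True show ?thesis by (auto simp: w_def indicator_def abs_le_iff)
  next
    case False
    then show ?thesis by (auto simp: h_def g_def w_def tent_def)
  qed
  have "(\<lambda>m. \<integral>x. (h n x - g m x)\<^sup>2 \<partial>lborel) \<longlonglongrightarrow> (\<integral>x. 0 \<partial>(lborel::real measure))"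
  proof (rule integral_dominated_convergence[OF _ _ w])
    show "AE x in lborel. (\<lambda>m. (h n x - g m x)\<^sup>2) \<longlonglongrightarrow> 0"
      using AE_N
    proof eventually_elim
      case (elim x)
      have "(\<lambda>m. (h n x - g m x)\<^sup>2) \<longlonglongrightarrow> (h n x - h n x)\<^sup>2"
        unfolding h_def g_def clip_def by (intro tendsto_intros lim elim)
      then show ?case by simp
    qed
  qed (use hg_le in auto)
  then have "\<forall>\<^sub>F m in sequentially. (\<integral>x. (h n x - g m x)\<^sup>2 \<partial>lborel) < \<eta> / 4"
    using \<open>0 < \<eta>\<close> by (intro order_tendstoD(2)) auto
  then obtain m where m: "(\<integral>x. (h n x - g m x)\<^sup>2 \<partial>lborel) < \<eta> / 4"
    by (auto simp: eventually_sequentially)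
  have int2: "integrable lborel (\<lambda>x. (h n x - g m x)\<^sup>2)"
    using hg_le by (intro Bochner_Integration.integrable_bound[OF w]) (auto intro!: AE_I2 order_trans[OF _ abs_ge_self])
  have int12: "integrable lborel (\<lambda>x. 2 * (f x - h n x)\<^sup>2 + 2 * (h n x - g m x)\<^sup>2)"
    using int1 int2 by simp
  have le: "(f x - g m x)\<^sup>2 \<le> 2 * (f x - h n x)\<^sup>2 + 2 * (h n x - g m x)\<^sup>2" for x
    using zero_le_power2[of "(f x - h n x) - (h n x - g m x)"] by (simp add: power2_eq_square algebra_simps)
  have int3: "integrable lborel (\<lambda>x. (f x - g m x)\<^sup>2)"
    using le by (intro Bochner_Integration.integrable_bound[OF int12]) (auto intro!: AE_I2 order_trans[OF _ abs_ge_self])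
  have "(\<integral>x. (f x - g m x)\<^sup>2 \<partial>lborel) \<le> (\<integral>x. 2 * (f x - h n x)\<^sup>2 + 2 * (h n x - g m x)\<^sup>2 \<partial>lborel)"
    by (intro integral_mono int3 int12 le)
  also have "\<dots> < \<eta>" using int1 int2 n m by simp
  finally have lt: "(\<integral>x. (f x - g m x)\<^sup>2 \<partial>lborel) < \<eta>" .
  show ?thesis
    by (rule that[OF g_cont[of m] _ int3 lt, of "real n + 1"]) (simp add: g_def tent_def)
qed

text \<open>Young's inequality with a free weight \<open>\<theta>\<close> does the work of
  Cauchy-Schwarz; it comes from expanding \<open>(\<bar>f x\<bar> - \<theta> * \<bar>g
  x\<bar>)\<^sup>2 / \<theta>\<close>. The weight plays a small first norm against a merely finite
  second one.\<close>

lemma integrable_mult_of_L2: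
  fixes f g :: "real \<Rightarrow> real"
  assumes [measurable]: "f \<in> borel_measurable M" "g \<in> borel_measurable M"
    and int: "integrable M (\<lambda>x. (f x)\<^sup>2)" "integrable M (\<lambda>x. (g x)\<^sup>2)"
  shows "integrable M (\<lambda>x. f x * g x)"
    and "0 < \<theta> \<Longrightarrow> \<bar>\<integral>x. f x * g x \<partial>M\<bar> \<le> ((\<integral>x. (f x)\<^sup>2 \<partial>M) / \<theta> + \<theta> * (\<integral>x. (g x)\<^sup>2 \<partial>M)) / 2"
proof -
  have le: "\<bar>f x * g x\<bar> \<le> ((f x)\<^sup>2 / \<theta> + \<theta> * (g x)\<^sup>2) / 2" if "0 < \<theta>" for \<theta> x
  proof -
    have "0 \<le> (\<bar>f x\<bar> - \<theta> * \<bar>g x\<bar>)\<^sup>2 / \<theta>" using that by simp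
    also have "\<dots> = (f x)\<^sup>2 / \<theta> + \<theta> * (g x)\<^sup>2 - 2 * \<bar>f x * g x\<bar>"
      using that by (simp add: power2_eq_square field_simps abs_mult)
    finally show ?thesis by simp
  qed
  have intl: "integrable M (\<lambda>x. ((f x)\<^sup>2 / \<theta> + \<theta> * (g x)\<^sup>2) / 2)" for \<theta>
    using int by simp
  show *: "integrable M (\<lambda>x. f x * g x)"
    by (rule Bochner_Integration.integrable_bound[OF intl[of 1]]) (use le[of 1] in \<open>auto intro!: AE_I2 order_trans[OF _ abs_ge_self]\<close>)
  show "\<bar>\<integral>x. f x * g x \<partial>M\<bar> \<le> ((\<integral>x. (f x)\<^sup>2 \<partial>M) / \<theta> + \<theta> * (\<integral>x. (g x)\<^sup>2 \<partial>M)) / 2" if "0 < \<theta>"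
  proof -
    have "\<bar>\<integral>x. f x * g x \<partial>M\<bar> \<le> (\<integral>x. \<bar>f x * g x\<bar> \<partial>M)"
      using integral_norm_bound[of M "\<lambda>x. f x * g x"] by simp
    also have "\<dots> \<le> (\<integral>x. ((f x)\<^sup>2 / \<theta> + \<theta> * (g x)\<^sup>2) / 2 \<partial>M)"
      using * by (intro integral_mono intl le that) simp
    finally show ?thesis using int by simp
  qed
qed

text \<open>\<open>K\<close> is replaced by a compactly supported continuous function in the first factor only:
  this changes the correlation uniformly little, and makes it continuous.\<close>

lemma continuous_correlation_L2:
  fixes K :: "real \<Rightarrow> real"
  assumes [measurable]: "K \<in> borel_measurable borel"
    and int: "integrable lborel (\<lambda>x. (K x)\<^sup>2)"
  shows "continuous_on UNIV (\<lambda>u. \<integral>v. K (u + v) * K v \<partial>lborel)"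
proof -
  define A where "A = (\<integral>v. (K v)\<^sup>2 \<partial>lborel)"
  have "A \<ge> 0" by (simp add: A_def)
  have shift: "integrable lborel (\<lambda>v. F (u + v))" "(\<integral>v. F (u + v) \<partial>lborel) = (\<integral>v. F v \<partial>lborel)"
    if "integrable lborel F" for F :: "real \<Rightarrow> real" and u
    using lborel_integrable_real_affine[OF that, of 1 u] lborel_integral_real_affine[of 1 F u] by simp_all
  have approx: "\<exists>c. continuous_on UNIV c \<and> (\<forall>u. dist (c u) (\<integral>v. K (u + v) * K v \<partial>lborel) < e)" if e: "e > 0" for e
  proof -
    \<comment> \<open>Chosen so that \<open>\<theta> * A \<le> e\<close>; a squared error below
      \<open>e * \<theta>\<close> becomes less than \<open>e\<close> after division by
      \<open>\<theta>\<close>. The added 1 covers \<open>A = 0\<close>.\<close>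
    define \<theta> where "\<theta> = e / (A + 1)"
    have \<theta>: "\<theta> > 0" using e \<open>A \<ge> 0\<close> by (simp add: \<theta>_def)
    obtain g R where g: "continuous_on UNIV g" "\<And>x. R < \<bar>x\<bar> \<Longrightarrow> g x = 0"
      "integrable lborel (\<lambda>x. (K x - g x)\<^sup>2)" "(\<integral>x. (K x - g x)\<^sup>2 \<partial>lborel) < e * \<theta>"
      using L2_approx_continuous[OF assms mult_pos_pos[OF e \<theta>]] by blast
    have [measurable]: "g \<in> borel_measurable borel"
      by (rule borel_measurable_continuous_onI[OF g(1)])
    obtain B where B: "\<And>x. \<bar>g x\<bar> \<le> B"
    proof -
      have "compact (g ` {-\<bar>R\<bar>..\<bar>R\<bar>})"
        by (intro compact_continuous_image continuous_on_subset[OF g(1)]) auto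
      then have "\<exists>B. \<forall>x\<in>{-\<bar>R\<bar>..\<bar>R\<bar>}. \<bar>g x\<bar> \<le> B"
        using compact_imp_bounded[of "g ` {-\<bar>R\<bar>..\<bar>R\<bar>}"] by (simp add: bounded_iff)
      then obtain B where B: "\<And>x. x \<in> {-\<bar>R\<bar>..\<bar>R\<bar>} \<Longrightarrow> \<bar>g x\<bar> \<le> B"
        by blast
      have "\<bar>g x\<bar> \<le> \<bar>B\<bar>" for x
        using B[of x] g(2)[of x] by (cases "x \<in> {-\<bar>R\<bar>..\<bar>R\<bar>}") (auto intro: order_trans[OF _ abs_ge_self])
      then show ?thesis using that by blast
    qed
    have B0: "B \<ge> 0" using B[of 0] by linarith
    define c where "c u = (\<integral>v. g (u + v) * K v \<partial>lborel)" for u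
    have gi: "integrable lborel (\<lambda>v. (g v)\<^sup>2)"
    proof (rule Bochner_Integration.integrable_bound)
      show "integrable lborel (\<lambda>v. 2 * (K v - g v)\<^sup>2 + 2 * (K v)\<^sup>2)" using g(3) int by simp
      \<comment> \<open>The right side exceeds the left by
        \<open>(2 * K v - g v)\<^sup>2\<close>.\<close>
      have "(g v)\<^sup>2 \<le> 2 * (K v - g v)\<^sup>2 + 2 * (K v)\<^sup>2" for v
        using zero_le_power2[of "2 * K v - g v"] by (simp add: power2_eq_square algebra_simps)
      then show "AE v in lborel. norm ((g v)\<^sup>2) \<le> norm (2 * (K v - g v)\<^sup>2 + 2 * (K v)\<^sup>2)"
        by (auto intro!: AE_I2 order_trans[OF _ abs_ge_self])
    qed simp
    have close: "dist (c u) (\<integral>v. K (u + v) * K v \<partial>lborel) < e" for u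
    proof -
      have i1: "integrable lborel (\<lambda>v. K (u + v) * K v)"
        by (rule integrable_mult_of_L2(1)) (use shift(1)[OF int] int in auto)
      have i2: "integrable lborel (\<lambda>v. g (u + v) * K v)"
        by (rule integrable_mult_of_L2(1)) (use shift(1)[OF gi] int in auto)
      have "(\<integral>v. K (u + v) * K v \<partial>lborel) - c u = (\<integral>v. (K (u + v) - g (u + v)) * K v \<partial>lborel)"
        using i1 i2 by (simp add: c_def left_diff_distrib)
      also have "\<bar>\<dots>\<bar> \<le> ((\<integral>v. (K (u + v) - g (u + v))\<^sup>2 \<partial>lborel) / \<theta> + \<theta> * A) / 2"
        unfolding A_def by (rule integrable_mult_of_L2(2)) (use shift(1)[OF g(3)] int \<theta> in auto)
      also have "(\<integral>v. (K (u + v) - g (u + v))\<^sup>2 \<partial>lborel) / \<theta> < e"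
        using g(4) \<theta> by (simp add: shift(2)[OF g(3)] pos_divide_less_eq)
      also have "\<theta> * A \<le> e"
        using e \<open>A \<ge> 0\<close> by (simp add: \<theta>_def field_simps)
      finally show ?thesis by (simp add: dist_real_def abs_minus_commute)
    qed
    have "continuous_on UNIV c"
      unfolding continuous_on_sequentially
    proof (intro ballI allI impI, elim conjE)
      fix x :: "nat \<Rightarrow> real" and u assume "x \<longlonglongrightarrow> u"
      then obtain b where b: "\<And>n. \<bar>x n\<bar> \<le> b"
        using convergent_imp_Bseq[of x] by (auto simp: convergent_def Bseq_def)
      \<comment> \<open>Since \<open>x n\<close> stays within \<open>b\<close>, the factor
        \<open>g (x n + v)\<close> vanishes for \<open>v\<close> outside this interval; on it
        \<open>K\<close> is integrable, as the product of two square integrable functions.\<close>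
      define w where "w v = B * (indicator {-R-b..R+b} v * \<bar>K v\<bar>)" for v
      have w: "integrable lborel w"
      proof -
        have "integrable lborel (indicator {-R-b..R+b} :: real \<Rightarrow> real)"
          by (rule integrable_real_indicator, simp, rule emeasure_bounded_finite, simp)
        moreover have "(\<lambda>v. (indicator {-R-b..R+b} v)\<^sup>2) = (indicator {-R-b..R+b} :: real \<Rightarrow> real)"
          by (auto simp: indicator_def)
        ultimately show ?thesis
          unfolding w_def by (intro integrable_mult_right integrable_mult_of_L2(1)) (use int in auto)
      qed
      have "(\<lambda>n. c (x n)) \<longlonglongrightarrow> c u"
        unfolding c_def
      proof (rule integral_dominated_convergence[OF _ _ w])
        show "AE v in lborel. (\<lambda>n. g (x n + v) * K v) \<longlonglongrightarrow> g (u + v) * K v"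
          using g(1) \<open>x \<longlonglongrightarrow> u\<close>
          by (intro AE_I2 tendsto_intros) (auto intro!: continuous_on_tendsto_compose[OF g(1)] tendsto_intros)
        have "\<bar>g (x n + v) * K v\<bar> \<le> w v" for n v
        proof (cases "v \<in> {-R-b..R+b}")
          case True
          then show ?thesis using B[of "x n + v"] by (simp add: w_def abs_mult mult_right_mono)
        next
          case False
          then have "R < \<bar>x n + v\<bar>" using b[of n] by auto
          then show ?thesis using g(2) False by (simp add: w_def)
        qed
        then show "AE v in lborel. norm (g (x n + v) * K v) \<le> w v" for n by simp
      qed auto
      then show "(c \<circ> x) \<longlonglongrightarrow> c u" by (simp add: comp_def)
    qed
    with close show ?thesis by blast
  qed
  have "\<forall>n. \<exists>c. continuous_on UNIV c \<and> (\<forall>u. dist (c u) (\<integral>v. K (u + v) * K v \<partial>lborel) < 1 / real (Suc n))"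
    using approx by simp
  then obtain c where c: "\<And>n. continuous_on UNIV (c n)"
    "\<And>n u. dist (c n u) (\<integral>v. K (u + v) * K v \<partial>lborel) < 1 / real (Suc n)"
    by metis
  have "uniform_limit UNIV c (\<lambda>u. \<integral>v. K (u + v) * K v \<partial>lborel) sequentially"
  proof (rule uniform_limitI)
    fix e :: real assume "e > 0"
    then obtain m where m: "1 / real (Suc m) < e" using reals_Archimedean by (auto simp: inverse_eq_divide)
    show "\<forall>\<^sub>F n in sequentially. \<forall>u\<in>UNIV. dist (c n u) (\<integral>v. K (u + v) * K v \<partial>lborel) < e"
      using eventually_ge_at_top[of m]
    proof eventually_elim
      case (elim n)
      then have "1 / real (Suc n) \<le> 1 / real (Suc m)" by (simp add: field_simps)
      with m c(2)[of n] show ?case by (meson less_trans order_le_less_trans)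
    qed
  qed
  then show ?thesis
    by (rule uniform_limit_theorem[rotated]) (use c(1) in auto)
qed

text \<open>\<open>K\<close> is only Lebesgue measurable and is replaced by a Borel version; for
  each \<open>u\<close> this alters the integrand only on a null set and a translate of it. The
  bound is Young's inequality with weight 1, both norms agreeing by translation invariance.\<close>

lemma autocorr_continuous_bounded:
  assumes "square_summable K"
  shows "continuous_on UNIV (autocorr K)" and "bounded (range (autocorr K))"
proof -
  have m: "K \<in> borel_measurable lebesgue" and i: "integrable lebesgue (\<lambda>v. (K v)\<^sup>2)"
    using assms by (auto simp: square_summable_def)
  obtain K' where [measurable]: "K' \<in> borel_measurable lborel" and eq: "AE x in lborel. K x = K' x"
    using completion_ex_borel_measurable_real[OF m] by blast
  have i': "integrable lborel (\<lambda>v. (K' v)\<^sup>2)"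
  proof -
    have "integrable lebesgue (\<lambda>v. (K' v)\<^sup>2)"
      using i by (rule integrable_cong_AE_imp) (use eq in \<open>auto intro!: AE_completion measurable_completion elim: eventually_mono\<close>)
    then show ?thesis by (subst (asm) integrable_completion) auto
  qed
  have ac: "autocorr K u = (\<integral>v. K' (u + v) * K' v \<partial>lborel)" for u
  proof -
    have "AE v in lborel. K (u + v) * K v = K' (u + v) * K' v"
      using eq AE_lborel_affine[OF eq, of 1 u, simplified] by eventually_elim simp
    then have AE: "AE v in lebesgue. K (u + v) * K v = K' (u + v) * K' v" by (rule AE_completion)
    have "(\<lambda>v. K' (u + v) * K' v) \<in> borel_measurable lebesgue" by (intro measurable_completion) measurable
    moreover have "(\<lambda>v. K (u + v) * K v) \<in> borel_measurable lebesgue"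
      by (rule borel_measurable_AE[OF calculation]) (use AE in \<open>auto elim: eventually_mono\<close>)
    ultimately have "autocorr K u = (\<integral>v. K' (u + v) * K' v \<partial>lebesgue)"
      unfolding autocorr_def using AE by (intro integral_cong_AE)
    then show ?thesis by (simp add: integral_completion)
  qed
  show "continuous_on UNIV (autocorr K)"
    unfolding ac[abs_def] by (rule continuous_correlation_L2) (use i' in auto)
  have "\<bar>autocorr K u\<bar> \<le> (\<integral>v. (K' v)\<^sup>2 \<partial>lborel)" for u
  proof -
    have "\<bar>autocorr K u\<bar> \<le> ((\<integral>v. (K' (u + v))\<^sup>2 \<partial>lborel) / 1 + 1 * (\<integral>v. (K' v)\<^sup>2 \<partial>lborel)) / 2"
      unfolding ac using i' lborel_integrable_real_affine[OF i', of 1 u]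
      by (intro integrable_mult_of_L2(2)) auto
    then show ?thesis using lborel_integral_real_affine[of 1 "\<lambda>v. (K' v)\<^sup>2" u] by simp
  qed
  then show "bounded (range (autocorr K))" by (auto simp: bounded_iff)
qed

section \<open>Gaussian test functions and Fourier inversion\<close>

text \<open>As \<open>\<delta>\<close> tends to 0 this tends to the pure exponential
  \<open>iexp (a * t)\<close>, while its Fourier integral is a Gaussian peak at \<open>a\<close> of
  width \<open>\<delta>\<close>. Used as a test function, it therefore gives inversion at the point
  \<open>a\<close>.\<close>

definition modulated_gaussian :: "real \<Rightarrow> real \<Rightarrow> real \<Rightarrow> complex" where
  "modulated_gaussian a \<delta> t = exp (\<i> * of_real (a * t) - of_real ((\<delta> * t)\<^sup>2 / 2))"

lemma norm_modulated_gaussian: "norm (modulated_gaussian a \<delta> t) = exp (- (\<delta> * t)\<^sup>2 / 2)"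
  by (simp add: modulated_gaussian_def)

text \<open>One term of the exponential series bounds \<open>y ^ i * exp (- y)\<close> and so
  controls the even power \<open>2 * i\<close> of \<open>t\<close>; the power \<open>i\<close>
  itself is reduced to it by \<open>x \<le> 1 + x * x\<close>.\<close>

lemma power_le_exp_gaussian:
  fixes \<delta> :: real assumes "0 < \<delta>"
  shows "\<bar>t\<bar> ^ i * exp (- (\<delta> * t)\<^sup>2 / 2) \<le> 1 + fact i * (2 / \<delta>\<^sup>2) ^ i"
proof -
  define y where "y = (\<delta> * t)\<^sup>2 / 2"
  have y: "y \<ge> 0" by (simp add: y_def)
  have "y ^ i / fact i \<le> exp y"
  proof -
    have "(\<Sum>n\<in>{i}. y ^ n /\<^sub>R fact n) \<le> (\<Sum>n. y ^ n /\<^sub>R fact n)"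
      by (rule sum_le_suminf) (use y summable_exp_generic[of y] in auto)
    then show ?thesis by (simp add: exp_def divide_inverse mult.commute)
  qed
  then have 1: "y ^ i * exp (- y) \<le> fact i"
    by (simp add: exp_minus field_simps)
  have "t\<^sup>2 = (2 / \<delta>\<^sup>2) * y" using assms by (simp add: y_def power_mult_distrib)
  moreover have "\<bar>t\<bar> ^ i * \<bar>t\<bar> ^ i = (t\<^sup>2) ^ i"
    by (simp add: power2_eq_square flip: power_mult_distrib)
  ultimately have "\<bar>t\<bar> ^ i * \<bar>t\<bar> ^ i * exp (- y) = (2 / \<delta>\<^sup>2) ^ i * (y ^ i * exp (- y))"
    by (simp add: power_mult_distrib del: power_divide times_divide_eq_left)
  also have "\<dots> \<le> (2 / \<delta>\<^sup>2) ^ i * fact i"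
    by (intro mult_left_mono 1) simp
  finally have 2: "\<bar>t\<bar> ^ i * \<bar>t\<bar> ^ i * exp (- y) \<le> fact i * (2 / \<delta>\<^sup>2) ^ i" by (simp add: mult.commute)
  have "\<bar>t\<bar> ^ i \<le> 1 + \<bar>t\<bar> ^ i * \<bar>t\<bar> ^ i"
    using zero_le_power2[of "\<bar>t\<bar> ^ i - 1 / 2"] by (simp add: power2_eq_square algebra_simps)
  then have "\<bar>t\<bar> ^ i * exp (- y) \<le> (1 + \<bar>t\<bar> ^ i * \<bar>t\<bar> ^ i) * exp (- y)"
    by (rule mult_right_mono) simp
  also have "\<dots> = exp (- y) + \<bar>t\<bar> ^ i * \<bar>t\<bar> ^ i * exp (- y)" by (simp add: algebra_simps)
  also have "\<dots> \<le> 1 + fact i * (2 / \<delta>\<^sup>2) ^ i" using 2 y by (intro add_mono) auto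
  finally show ?thesis by (simp add: y_def)
qed

lemma bounded_poly_gaussian:
  fixes p :: "complex poly"
  assumes "0 < \<delta>"
  shows "bounded (range (\<lambda>t. poly p (of_real t) * modulated_gaussian a \<delta> t))"
proof -
  have "norm (poly p (of_real t) * modulated_gaussian a \<delta> t) \<le>
      (\<Sum>i\<le>degree p. norm (coeff p i) * (1 + fact i * (2 / \<delta>\<^sup>2) ^ i))" for t
  proof -
    have "norm (poly p (of_real t) * modulated_gaussian a \<delta> t) =
        norm (\<Sum>i\<le>degree p. coeff p i * of_real t ^ i) * exp (- (\<delta> * t)\<^sup>2 / 2)"
      by (simp add: norm_mult norm_modulated_gaussian poly_altdef)
    also have "\<dots> \<le> (\<Sum>i\<le>degree p. norm (coeff p i) * \<bar>t\<bar> ^ i) * exp (- (\<delta> * t)\<^sup>2 / 2)"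
      by (intro mult_right_mono sum_norm_le) (auto simp: norm_mult norm_power)
    also have "\<dots> = (\<Sum>i\<le>degree p. norm (coeff p i) * (\<bar>t\<bar> ^ i * exp (- (\<delta> * t)\<^sup>2 / 2)))"
      by (simp add: sum_distrib_right mult.assoc)
    also have "\<dots> \<le> (\<Sum>i\<le>degree p. norm (coeff p i) * (1 + fact i * (2 / \<delta>\<^sup>2) ^ i))"
      by (intro sum_mono mult_left_mono power_le_exp_gaussian assms) auto
    finally show ?thesis .
  qed
  then show ?thesis unfolding bounded_iff by blast
qed

text \<open>Every derivative is a polynomial times the same function, so boundedness of such
  products is enough.\<close>

lemma schwartz_modulated_gaussian:
  assumes "0 < \<delta>"
  shows "schwartz (modulated_gaussian a \<delta>)"
proof -
  \<comment> \<open>The linear factor is the logarithmic derivative of the modulated Gaussian, so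
    the recursion is the product rule.\<close>
  define p :: "nat \<Rightarrow> complex poly" where
    "p = rec_nat 1 (\<lambda>_ q. pderiv q + [:\<i> * of_real a, - of_real (\<delta>\<^sup>2):] * q)"
  have p0: "p 0 = 1" and pS: "p (Suc n) = pderiv (p n) + [:\<i> * of_real a, - of_real (\<delta>\<^sup>2):] * p n" for n
    by (simp_all add: p_def)
  \<comment> \<open>An entire extension, whose complex derivative is then restricted to the real
    line.\<close>
  define E where "E z = exp (\<i> * of_real a * z - of_real (\<delta>\<^sup>2) * z\<^sup>2 / 2)" for z :: complex
  have E: "modulated_gaussian a \<delta> t = E (of_real t)" for t
    by (simp add: modulated_gaussian_def E_def power_mult_distrib mult.assoc)
  define D where "D n t = poly (p n) (of_real t) * modulated_gaussian a \<delta> t" for n t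
  have deriv: "(D n has_vector_derivative D (Suc n) t) (at t)" for n t
  proof -
    have "((\<lambda>z. poly (p n) z * E z) has_field_derivative poly (p (Suc n)) (of_real t) * E (of_real t)) (at (of_real t))"
      unfolding E_def pS by (auto intro!: derivative_eq_intros simp: algebra_simps)
    then show ?thesis
      unfolding D_def E by (rule has_vector_derivative_real_field)
  qed
  have bdd: "bounded (range (\<lambda>t. t ^ m *\<^sub>R D n t))" for m n
  proof -
    have "(\<lambda>t. t ^ m *\<^sub>R D n t) = (\<lambda>t. poly (monom 1 m * p n) (of_real t) * modulated_gaussian a \<delta> t)"
      by (simp add: D_def fun_eq_iff scaleR_conv_of_real poly_monom mult.assoc)
    then show ?thesis using bounded_poly_gaussian[OF assms, of "monom 1 m * p n" a] by (simp only:)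
  qed
  show ?thesis
    unfolding schwartz_def
    by (intro exI[of _ D] conjI allI deriv bdd) (simp add: D_def p0 fun_eq_iff)
qed

text \<open>After the substitution \<open>u = \<delta> * t\<close> the integral is the standard
  normal characteristic function at \<open>b\<close>. The constant \<open>2 * pi\<close> collects
  two factors \<open>sqrt (2 * pi)\<close>: one from normalising the Gaussian under the integral,
  one from reading the result as a normal density.\<close>

lemma fourier_integral_modulated_gaussian:
  assumes "0 < \<delta>"
  shows "fourier_integral (modulated_gaussian a \<delta>) x = of_real (2 * pi / \<delta> * std_normal_density ((x - a) / \<delta>))"
proof -
  define b where "b = (a - x) / \<delta>"
  have m: "(\<lambda>t. exp (- \<i> * complex_of_real (t * x)) * modulated_gaussian a \<delta> t) \<in> borel_measurable borel"
    unfolding modulated_gaussian_def by measurable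
  have eq: "exp (- \<i> * complex_of_real (t * x)) * modulated_gaussian a \<delta> t =
     of_real (sqrt (2 * pi)) * (of_real (std_normal_density (0 + \<delta> * t)) * iexp (b * (0 + \<delta> * t)))" for t
  proof -
    have "exp (- \<i> * complex_of_real (t * x)) * modulated_gaussian a \<delta> t = exp (of_real (- (\<delta> * t)\<^sup>2 / 2)) * iexp (b * (\<delta> * t))"
    proof -
      have b: "b * (\<delta> * t) = (a - x) * t" using assms by (simp add: b_def)
      show ?thesis unfolding modulated_gaussian_def exp_add[symmetric] b by (simp add: algebra_simps)
    qed
    then show ?thesis by (simp add: std_normal_density_def flip: exp_of_real)
  qed
  have "fourier_integral (modulated_gaussian a \<delta>) x = (\<integral>t. of_real (sqrt (2 * pi)) * (of_real (std_normal_density (0 + \<delta> * t)) * iexp (b * (0 + \<delta> * t))) \<partial>lborel)"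
    unfolding fourier_integral_def eq[symmetric] by (rule integral_completion) (use m in simp)
  also have "\<dots> = of_real (sqrt (2 * pi)) * (\<integral>t. of_real (std_normal_density (0 + \<delta> * t)) * iexp (b * (0 + \<delta> * t)) \<partial>lborel)"
    by (rule integral_mult_right_zero)
  also have "(\<integral>t. of_real (std_normal_density (0 + \<delta> * t)) * iexp (b * (0 + \<delta> * t)) \<partial>lborel) =
      (1 / \<delta>) *\<^sub>R (\<integral>u. of_real (std_normal_density u) * iexp (b * u) \<partial>lborel)"
    using lborel_integral_real_affine[of \<delta> "\<lambda>u. of_real (std_normal_density u) * iexp (b * u)" 0] assms by simp
  also have "(\<integral>u. of_real (std_normal_density u) * iexp (b * u) \<partial>lborel) = char std_normal_distribution b"
    unfolding char_def by (subst integral_density) (auto simp: scaleR_conv_of_real)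
  also have "\<dots> = of_real (exp (- (b\<^sup>2) / 2))"
    by (simp add: char_std_normal_distribution)
  also have "exp (- (b\<^sup>2) / 2) = sqrt (2 * pi) * std_normal_density ((x - a) / \<delta>)"
    by (simp add: std_normal_density_def b_def power2_commute[of a x] power_divide)
  also have "of_real (sqrt (2 * pi)) * ((1 / \<delta>) *\<^sub>R complex_of_real (sqrt (2 * pi) * std_normal_density ((x - a) / \<delta>))) =
     of_real ((sqrt (2 * pi) * sqrt (2 * pi)) / \<delta> * std_normal_density ((x - a) / \<delta>))"
    by (simp only: scaleR_conv_of_real of_real_mult of_real_divide) simp
  finally show ?thesis by simp
qed

text \<open>At the point 0 the Gaussian test functions are positive and increase to 1 while the
  pairings converge, so monotone convergence makes \<open>\<Psi>\<close> integrable. Only then does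
  dominated convergence give inversion at every point.\<close>

lemma autocorr_eq_char:
  fixes K \<Psi> :: "real \<Rightarrow> real"
  assumes K: "square_summable K"
    and ft: "is_fourier_transform (\<lambda>u. complex_of_real (autocorr K u)) (\<lambda>t. complex_of_real (\<Psi> t))"
    and nonneg: "AE t in lebesgue. 0 \<le> \<Psi> t" and nz: "AE t in lebesgue. \<Psi> t \<noteq> 0"
  obtains \<nu> c where "real_distribution \<nu>" "0 < c"
    "\<And>u. complex_of_real (autocorr K u) = of_real c * char \<nu> u"
    "\<And>a b. a < b \<Longrightarrow> 0 < measure \<nu> {a<..<b}"
proof -
  have "(\<lambda>t. complex_of_real (\<Psi> t)) \<in> borel_measurable lebesgue"
    using ft by (simp add: is_fourier_transform_def)
  then have "(\<lambda>t. Re (complex_of_real (\<Psi> t))) \<in> borel_measurable lebesgue" by measurable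
  then have "\<Psi> \<in> borel_measurable (completion lborel)" by simp
  then obtain g where g [measurable]: "g \<in> borel_measurable lborel" and eq: "AE t in lborel. \<Psi> t = g t"
    using completion_ex_borel_measurable_real by blast
  \<comment> \<open>A Borel version of \<open>\<Psi>\<close> that is nonnegative everywhere, as a
    density must be.\<close>
  define \<psi> where "\<psi> t = max 0 (g t)" for t
  have [measurable]: "\<psi> \<in> borel_measurable borel" unfolding \<psi>_def using g by simp
  have \<psi>0: "\<psi> t \<ge> 0" for t by (simp add: \<psi>_def)
  have pos: "AE t in lborel. \<psi> t > 0" and \<psi>: "AE t in lborel. \<Psi> t = \<psi> t"
    using eq nonneg nz unfolding AE_completion_iff by (eventually_elim; auto simp: \<psi>_def)+
  note cont = autocorr_continuous_bounded(1)[OF K]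
  obtain B where B: "\<And>u. \<bar>autocorr K u\<bar> \<le> B"
    using autocorr_continuous_bounded(2)[OF K] by (auto simp: bounded_iff)
  have [measurable]: "autocorr K \<in> borel_measurable borel"
    by (rule borel_measurable_continuous_onI[OF cont])
  have [measurable]: "modulated_gaussian a \<delta> \<in> borel_measurable borel" for a \<delta>
    unfolding modulated_gaussian_def[abs_def] by measurable

  have AE\<psi>: "AE t in lebesgue. complex_of_real (\<Psi> t) * F t = of_real (\<psi> t) * F t" for F
    using AE_completion[OF \<psi>] by eventually_elim simp
  have gauss: "integrable lborel (\<lambda>t. of_real (\<psi> t) * modulated_gaussian a \<delta> t)"
    "(\<integral>t. of_real (\<psi> t) * modulated_gaussian a \<delta> t \<partial>lborel) =
      of_real (2 * pi * (\<integral>u. autocorr K (a + \<delta> * u) * std_normal_density u \<partial>lborel))"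
    if \<delta>: "0 < \<delta>" for a \<delta>
  proof -
    have meas: "(\<lambda>t. of_real (\<psi> t) * modulated_gaussian a \<delta> t) \<in> borel_measurable lebesgue"
      by (intro measurable_completion) measurable
    have 1: "integrable lebesgue (\<lambda>t. complex_of_real (\<Psi> t) * modulated_gaussian a \<delta> t)"
      and 2: "(LINT x|lebesgue. complex_of_real (autocorr K x) * fourier_integral (modulated_gaussian a \<delta>) x) =
        (LINT t|lebesgue. complex_of_real (\<Psi> t) * modulated_gaussian a \<delta> t)"
      using ft schwartz_modulated_gaussian[OF \<delta>, of a] unfolding is_fourier_transform_def by blast+
    have "integrable lebesgue (\<lambda>t. of_real (\<psi> t) * modulated_gaussian a \<delta> t)"
      by (rule integrable_cong_AE_imp[OF 1 meas]) (rule AE\<psi>)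
    then show "integrable lborel (\<lambda>t. of_real (\<psi> t) * modulated_gaussian a \<delta> t)"
      by (subst (asm) integrable_completion) auto
    have "(\<integral>t. of_real (\<psi> t) * modulated_gaussian a \<delta> t \<partial>lborel) = (LINT t|lebesgue. of_real (\<psi> t) * modulated_gaussian a \<delta> t)"
      by (rule integral_completion[symmetric]) measurable
    also have "\<dots> = (LINT t|lebesgue. complex_of_real (\<Psi> t) * modulated_gaussian a \<delta> t)"
      by (rule integral_cong_AE[OF meas borel_measurable_integrable[OF 1] eventually_mono[OF AE\<psi> sym]])
    also have "\<dots> = (LINT x|lebesgue. complex_of_real (autocorr K x * (2 * pi / \<delta> * std_normal_density ((x - a) / \<delta>))))"
      unfolding 2[symmetric] by (simp add: fourier_integral_modulated_gaussian[OF \<delta>])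
    also have "\<dots> = of_real (\<integral>x. autocorr K x * (2 * pi / \<delta> * std_normal_density ((x - a) / \<delta>)) \<partial>lborel)"
      unfolding integral_complex_of_real by (subst integral_completion) auto
    also have "(\<integral>x. autocorr K x * (2 * pi / \<delta> * std_normal_density ((x - a) / \<delta>)) \<partial>lborel) =
        \<delta> *\<^sub>R (\<integral>u. autocorr K (a + \<delta> * u) * (2 * pi / \<delta> * std_normal_density ((a + \<delta> * u - a) / \<delta>)) \<partial>lborel)"
      using lborel_integral_real_affine[of \<delta> "\<lambda>x. autocorr K x * (2 * pi / \<delta> * std_normal_density ((x - a) / \<delta>))" a] \<delta>
      by simp
    also have "(\<integral>u. autocorr K (a + \<delta> * u) * (2 * pi / \<delta> * std_normal_density ((a + \<delta> * u - a) / \<delta>)) \<partial>lborel) =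
        (\<integral>u. (2 * pi / \<delta>) * (autocorr K (a + \<delta> * u) * std_normal_density u) \<partial>lborel)"
      using \<delta> by (intro Bochner_Integration.integral_cong) auto
    also have "\<delta> *\<^sub>R \<dots> = 2 * pi * (\<integral>u. autocorr K (a + \<delta> * u) * std_normal_density u \<partial>lborel)"
      using \<delta> by (subst integral_mult_right_zero) simp
    finally show "(\<integral>t. of_real (\<psi> t) * modulated_gaussian a \<delta> t \<partial>lborel) =
      of_real (2 * pi * (\<integral>u. autocorr K (a + \<delta> * u) * std_normal_density u \<partial>lborel))" .
  qed
  \<comment> \<open>A decreasing sequence of widths, so that the Gaussians at the point 0
    increase.\<close>
  define d where "d n = 1 / real (Suc n)" for n
  have d: "0 < d n" "d (Suc n) \<le> d n" for n by (auto simp: d_def field_simps)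
  have d0: "d \<longlonglongrightarrow> 0" unfolding d_def by (rule LIMSEQ_Suc[OF lim_1_over_n])
  \<comment> \<open>The substitution \<open>x = a + \<delta> * u\<close> has turned the pairing into
    an average of \<open>autocorr K\<close> under a fixed normal density; continuity gives the
    limit, boundedness the dominating function.\<close>
  have lim: "(\<lambda>n. 2 * pi * (\<integral>u. autocorr K (a + d n * u) * std_normal_density u \<partial>lborel)) \<longlonglongrightarrow> 2 * pi * autocorr K a" for a
  proof -
    have int: "integrable lborel (\<lambda>u. B * std_normal_density u)" by (intro integrable_mult_right) simp
    have "(\<lambda>n. \<integral>u. autocorr K (a + d n * u) * std_normal_density u \<partial>lborel) \<longlonglongrightarrow> (\<integral>u. autocorr K a * std_normal_density u \<partial>lborel)"
    proof (rule integral_dominated_convergence[OF _ _ int])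
      show "AE u in lborel. (\<lambda>n. autocorr K (a + d n * u) * std_normal_density u) \<longlonglongrightarrow> autocorr K a * std_normal_density u"
      proof (intro AE_I2 tendsto_mult_right continuous_on_tendsto_compose[OF cont])
        fix u
        have "(\<lambda>n. a + d n * u) \<longlonglongrightarrow> a + 0 * u" by (intro tendsto_intros d0)
        then show "(\<lambda>n. a + d n * u) \<longlonglongrightarrow> a" by simp
      qed auto
      show "AE u in lborel. norm (autocorr K (a + d n * u) * std_normal_density u) \<le> B * std_normal_density u" for n
        by (intro AE_I2) (simp add: abs_mult B mult_right_mono)
    qed auto
    then show ?thesis by (intro tendsto_mult_left) simp
  qed
  have gauss_lim: "(\<lambda>n. modulated_gaussian a (d n) t) \<longlonglongrightarrow> iexp (a * t)" for a t
  proof -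
    have "(\<lambda>n. exp (\<i> * of_real (a * t) - of_real ((d n * t)\<^sup>2 / 2))) \<longlonglongrightarrow> exp (\<i> * of_real (a * t) - of_real ((0 * t)\<^sup>2 / 2))"
      by (intro tendsto_intros d0) auto
    then show ?thesis by (simp add: modulated_gaussian_def)
  qed
  have g0: "modulated_gaussian 0 \<delta> t = of_real (exp (- (\<delta> * t)\<^sup>2 / 2))" for \<delta> t
    by (simp add: modulated_gaussian_def flip: exp_of_real)
  have i0: "integrable lborel (\<lambda>t. \<psi> t * exp (- (d n * t)\<^sup>2 / 2))" for n
    using integrable_Re[OF gauss(1)[OF d(1), of 0 n]] by (simp add: g0 flip: of_real_mult)
  have v0: "(\<integral>t. \<psi> t * exp (- (d n * t)\<^sup>2 / 2) \<partial>lborel) = 2 * pi * (\<integral>u. autocorr K (0 + d n * u) * std_normal_density u \<partial>lborel)" for n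
    using gauss(2)[OF d(1), of 0 n] unfolding g0 of_real_mult[symmetric] integral_complex_of_real of_real_eq_iff .
  have int\<psi>: "integrable lborel \<psi>" and val\<psi>: "(\<integral>t. \<psi> t \<partial>lborel) = 2 * pi * autocorr K 0"
  proof -
    have mono: "AE t in lborel. mono (\<lambda>n. \<psi> t * exp (- (d n * t)\<^sup>2 / 2))"
    proof (intro AE_I2 incseq_SucI mult_left_mono)
      fix t n
      have "(d (Suc n) * t)\<^sup>2 \<le> (d n * t)\<^sup>2"
        unfolding power_mult_distrib using d[of n] d(1)[of "Suc n"] by (intro mult_right_mono power_mono) auto
      then show "exp (- (d n * t)\<^sup>2 / 2) \<le> exp (- (d (Suc n) * t)\<^sup>2 / 2)" by simp
    qed (rule \<psi>0)
    have ptw: "AE t in lborel. (\<lambda>n. \<psi> t * exp (- (d n * t)\<^sup>2 / 2)) \<longlonglongrightarrow> \<psi> t"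
    proof (rule AE_I2)
      fix t
      have "(\<lambda>n. \<psi> t * exp (- (d n * t)\<^sup>2 / 2)) \<longlonglongrightarrow> \<psi> t * exp (- (0 * t)\<^sup>2 / 2)"
        by (intro tendsto_intros d0) auto
      then show "(\<lambda>n. \<psi> t * exp (- (d n * t)\<^sup>2 / 2)) \<longlonglongrightarrow> \<psi> t" by simp
    qed
    have il: "(\<lambda>n. \<integral>t. \<psi> t * exp (- (d n * t)\<^sup>2 / 2) \<partial>lborel) \<longlonglongrightarrow> 2 * pi * autocorr K 0"
      unfolding v0 by (rule lim)
    show "integrable lborel \<psi>" "(\<integral>t. \<psi> t \<partial>lborel) = 2 * pi * autocorr K 0"
      by (rule integral_monotone_convergence_nonneg[OF i0 mono _ ptw il]; simp add: \<psi>0)+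
  qed
  have inversion: "(\<integral>t. of_real (\<psi> t) * iexp (a * t) \<partial>lborel) = of_real (2 * pi * autocorr K a)" for a
  proof (rule LIMSEQ_unique)
    show "(\<lambda>n. \<integral>t. of_real (\<psi> t) * modulated_gaussian a (d n) t \<partial>lborel) \<longlonglongrightarrow> (\<integral>t. of_real (\<psi> t) * iexp (a * t) \<partial>lborel)"
    proof (rule integral_dominated_convergence[OF _ _ int\<psi>])
      show "AE t in lborel. norm (of_real (\<psi> t) * modulated_gaussian a (d n) t) \<le> \<psi> t" for n
        by (intro AE_I2) (simp add: norm_mult norm_modulated_gaussian \<psi>0 mult_left_le)
      show "AE t in lborel. (\<lambda>n. of_real (\<psi> t) * modulated_gaussian a (d n) t) \<longlonglongrightarrow> of_real (\<psi> t) * iexp (a * t)"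
        by (intro AE_I2 tendsto_mult_left gauss_lim)
    qed auto
    show "(\<lambda>n. \<integral>t. of_real (\<psi> t) * modulated_gaussian a (d n) t \<partial>lborel) \<longlonglongrightarrow> of_real (2 * pi * autocorr K a)"
      unfolding gauss(2)[OF d(1)] by (intro tendsto_of_real lim)
  qed
  have interval_pos: "\<not> (AE t in lborel. \<psi> t * indicator {a<..<b} t = 0)" if "a < b" for a b
  proof
    assume "AE t in lborel. \<psi> t * indicator {a<..<b} t = 0"
    with pos have "AE t in lborel. t \<notin> {a<..<b}" by eventually_elim (auto simp: indicator_def split: if_splits)
    then have "{a<..<b} \<in> null_sets lborel" by (subst (asm) AE_iff_null_sets[symmetric]) auto
    then show False using that by (simp add: null_sets_def)
  qed
  \<comment> \<open>By inversion at 0 this is the total mass of \<open>\<psi>\<close> divided by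
    \<open>2 * pi\<close>, and positivity almost everywhere excludes the value 0.\<close>
  define c where "c = autocorr K 0"
  have "c > 0"
  proof (rule ccontr)
    assume "\<not> c > 0"
    moreover have "(\<integral>t. \<psi> t \<partial>lborel) \<ge> 0" by (simp add: \<psi>0)
    ultimately have "(\<integral>t. \<psi> t \<partial>lborel) = 0" unfolding val\<psi> c_def using pi_gt_zero by (auto simp: zero_le_mult_iff)
    then have "AE t in lborel. \<psi> t = 0"
      by (subst (asm) integral_nonneg_eq_0_iff_AE[OF int\<psi>]) (auto simp: \<psi>0)
    then have "AE t in lborel. \<psi> t * indicator {0<..<1} t = 0" by eventually_elim simp
    with interval_pos[of 0 1] show False by simp
  qed
  define f where "f t = \<psi> t / (2 * pi * c)" for t
  have f0: "f t \<ge> 0" for t using \<psi>0 \<open>c > 0\<close> by (simp add: f_def)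
  have [measurable]: "f \<in> borel_measurable borel" unfolding f_def by measurable
  have intf: "integrable lborel f" and valf: "(\<integral>t. f t \<partial>lborel) = 1"
    using int\<psi> val\<psi> \<open>c > 0\<close> by (simp_all add: f_def[abs_def] c_def)
  define \<nu> where "\<nu> = density lborel (\<lambda>t. ennreal (f t))"
  have prob: "prob_space \<nu>"
  proof
    have "emeasure \<nu> (space \<nu>) = (\<integral>\<^sup>+t. ennreal (f t) \<partial>lborel)"
      by (simp add: \<nu>_def emeasure_density)
    also have "\<dots> = ennreal 1" using nn_integral_eq_integral[OF intf] f0 valf by simp
    finally show "emeasure \<nu> (space \<nu>) = 1" by simp
  qed
  interpret \<nu>: prob_space \<nu> by (rule prob)
  show ?thesis
  proof (rule that)
    show "real_distribution \<nu>"
      unfolding real_distribution_def real_distribution_axioms_def using prob by (simp add: \<nu>_def)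
    show "c > 0" by fact
    show "complex_of_real (autocorr K u) = of_real c * char \<nu> u" for u
    proof -
      have "char \<nu> u = (\<integral>t. f t *\<^sub>R iexp (u * t) \<partial>lborel)"
        unfolding char_def \<nu>_def by (subst integral_density) (auto simp: f0)
      also have "\<dots> = (\<integral>t. (1 / of_real (2 * pi * c)) * (of_real (\<psi> t) * iexp (u * t)) \<partial>lborel)"
        by (intro Bochner_Integration.integral_cong) (auto simp: f_def scaleR_conv_of_real)
      also have "\<dots> = (1 / of_real (2 * pi * c)) * of_real (2 * pi * autocorr K u)"
        by (subst integral_mult_right_zero) (simp only: inversion)
      finally show ?thesis using \<open>c > 0\<close> by simp
    qed
    show "0 < measure \<nu> {a<..<b}" if "a < b" for a b
    proof (rule ccontr)
      assume "\<not> 0 < measure \<nu> {a<..<b}"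
      then have "emeasure \<nu> {a<..<b} = 0"
        by (simp add: \<nu>.emeasure_eq_measure not_less measure_le_0_iff)
      then have "(\<integral>\<^sup>+t. ennreal (f t) * indicator {a<..<b} t \<partial>lborel) = 0"
        by (simp add: \<nu>_def emeasure_density)
      then have "AE t in lborel. ennreal (f t) * indicator {a<..<b} t = 0"
        by (subst (asm) nn_integral_0_iff_AE) auto
      then have "AE t in lborel. \<psi> t * indicator {a<..<b} t = 0"
      proof eventually_elim
        case (elim t)
        then show ?case using mult_pos_pos[OF pi_gt_zero \<open>c > 0\<close>] \<psi>0[of t] by (auto simp: f_def indicator_def ennreal_eq_0_iff divide_le_0_iff split: if_splits)
      qed
      with interval_pos[OF that] show False by simp
    qed
  qed
qed

section \<open>The estimator as a distance of empirical characteristic functions\<close>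

text \<open>The empirical characteristic function of the rescaled sample. The exponential of the
  inner product is split over the coordinates, so that integrals over a product measure
  factorise.\<close>

definition ecf :: "('k::finite \<Rightarrow> real) \<Rightarrow> nat \<Rightarrow> (nat \<Rightarrow> real ^ 'k) \<Rightarrow> ('k \<Rightarrow> real) \<Rightarrow> complex" where
  "ecf \<sigma> N y t = (1 / of_nat N) * (\<Sum>n=1..N. \<Prod>k\<in>UNIV. cis (t k * (y n $ k / \<sigma> k)))"

definition ecf_marginal :: "('k::finite \<Rightarrow> real) \<Rightarrow> nat \<Rightarrow> (nat \<Rightarrow> real ^ 'k) \<Rightarrow> 'k \<Rightarrow> real \<Rightarrow> complex" where
  "ecf_marginal \<sigma> N y k s = (1 / of_nat N) * (\<Sum>n=1..N. cis (s * (y n $ k / \<sigma> k)))"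

lemma norm_average_le_1:
  fixes f :: "nat \<Rightarrow> complex"
  assumes "\<And>n. norm (f n) \<le> 1"
  shows "norm ((1 / of_nat N) * (\<Sum>n=1..N. f n)) \<le> 1"
proof -
  have "norm (\<Sum>n=1..N. f n) \<le> real N"
    using sum_norm_le[of "{1..N}" f "\<lambda>_. 1"] assms by simp
  then show ?thesis by (cases "N = 0") (auto simp: norm_mult norm_divide field_simps)
qed

text \<open>The double mean keeps the diagonal \<open>m = n\<close>; this makes it an exact product,
  and the estimator an exact squared distance without correction terms.\<close>

lemma average_average_cnj:
  fixes u v :: "nat \<Rightarrow> complex"
  shows "(1 / of_nat N) * (\<Sum>m=1..N. (1 / of_nat N) * (\<Sum>n=1..N. u m * cnj (v n))) =
    ((1 / of_nat N) * (\<Sum>n=1..N. u n)) * cnj ((1 / of_nat N) * (\<Sum>n=1..N. v n))"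
  unfolding sum_distrib_left[symmetric] sum_distrib_right[symmetric] complex_cnj_mult cnj_sum by simp

lemma norm_ecf_le_1: "norm (ecf \<sigma> N y t) \<le> 1"
  unfolding ecf_def by (rule norm_average_le_1) (simp flip: prod_norm)

lemma norm_ecf_marginal_le_1: "norm (ecf_marginal \<sigma> N y k s) \<le> 1"
  unfolding ecf_marginal_def by (rule norm_average_le_1) simp

lemma norm_prod_ecf_marginal_le_1: "norm (\<Prod>k\<in>UNIV. ecf_marginal \<sigma> N y k (t k)) \<le> 1"
  by (auto simp flip: prod_norm intro!: prod_le_1 norm_ecf_marginal_le_1)

lemma ecf_measurable [measurable]:
  assumes [measurable_cong]: "sets \<nu> = sets borel"
  shows "ecf \<sigma> N y \<in> borel_measurable (PiM UNIV (\<lambda>_. \<nu>))"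
    and "(\<lambda>t. \<Prod>k\<in>UNIV. ecf_marginal \<sigma> N y k (t k)) \<in> borel_measurable (PiM UNIV (\<lambda>_. \<nu>))"
  unfolding ecf_def ecf_marginal_def by measurable

text \<open>Each kernel value contributes one factor \<open>a\<close> and one frequency, and the
  exponential of a difference splits into one factor per sample point. With \<open>f\<close> the
  joint mean and \<open>g\<close> the product of the marginal means, the three terms become the
  integrals of \<open>f * cnj f\<close>, \<open>g * cnj g\<close> and
  \<open>f * cnj g\<close>.\<close>

lemma Q_hat_eq_integral:
  fixes \<kappa> :: "real \<Rightarrow> real" and \<sigma> :: "'k::finite \<Rightarrow> real"
  assumes "real_distribution \<nu>"
    and kernel: "\<And>x. complex_of_real (\<kappa> x) = of_real a * char \<nu> x"
  shows "Q_hat \<kappa> \<sigma> N y = a ^ CARD('k) / 2 *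
    (\<integral>t. (norm (ecf \<sigma> N y t - (\<Prod>k\<in>UNIV. ecf_marginal \<sigma> N y k (t k))))\<^sup>2 \<partial>PiM UNIV (\<lambda>_. \<nu>))"
proof -
  interpret \<nu>: real_distribution \<nu> by fact
  interpret Pi: product_prob_space "\<lambda>_::'k. \<nu>" UNIV by unfold_locales
  have P: "prob_space (PiM UNIV (\<lambda>_::'k. \<nu>))" by (intro prob_space_PiM) unfold_locales
  define \<rho> where "\<rho> = PiM UNIV (\<lambda>_::'k. \<nu>)"
  define e where "e m t = (\<Prod>k\<in>UNIV. cis (t k * (y m $ k / \<sigma> k)))" for m and t :: "'k \<Rightarrow> real"
  define f where "f = ecf \<sigma> N y"
  define g where "g t = (\<Prod>k\<in>UNIV. ecf_marginal \<sigma> N y k (t k))" for t :: "'k \<Rightarrow> real"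
  have [measurable]: "f \<in> borel_measurable \<rho>" "g \<in> borel_measurable \<rho>"
    unfolding f_def g_def[abs_def] \<rho>_def by (rule ecf_measurable; simp)+
  have [measurable]: "e m \<in> borel_measurable \<rho>" for m
    unfolding e_def \<rho>_def by measurable
  have [simp]: "norm (e m t) = 1" for m t by (simp add: e_def flip: prod_norm)
  have nf: "norm (f t) \<le> 1" and ng: "norm (g t) \<le> 1" for t
    by (simp_all add: f_def g_def norm_ecf_le_1 norm_prod_ecf_marginal_le_1)
  have int: "integrable \<rho> F" if "F \<in> borel_measurable \<rho>" "\<And>t. norm (F t) \<le> 1" for F :: "('k \<Rightarrow> real) \<Rightarrow> complex"
    using that unfolding \<rho>_def by (intro finite_measure.integrable_const_bound[OF prob_space.finite_measure[OF P], of _ 1]) auto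
  have kc: "complex_of_real (\<kappa> x) = of_real a * (\<integral>s. cis (s * x) \<partial>\<nu>)" for x
    by (simp add: kernel char_def cis_conv_exp mult.commute)
  have intc: "integrable \<nu> (\<lambda>s. cis (s * x))" for x
    by (rule \<nu>.integrable_const_bound[of _ 1]) auto
  have intc': "integrable \<nu> (\<lambda>s. cis (s * u / v))" for u v
    using intc[of "u / v"] by simp
  have prod: "(\<Prod>k\<in>UNIV. \<integral>s. F k s \<partial>\<nu>) = (\<integral>t. (\<Prod>k\<in>UNIV. F k (t k)) \<partial>\<rho>)"
    if [measurable]: "\<And>k. F k \<in> borel_measurable borel" and "\<And>k s. norm (F k s) \<le> 1" for F :: "'k \<Rightarrow> real \<Rightarrow> complex"
    unfolding \<rho>_def
    by (subst Pi.product_integral_prod) (auto intro!: \<nu>.integrable_const_bound[of _ 1] that(2))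
  have cis_diff: "cis (s * ((u - v) / w)) = cis (s * (u / w)) * cnj (cis (s * (v / w)))" for s u v w
    by (simp add: cis_cnj cis_mult right_diff_distrib diff_divide_distrib)

  have joint: "complex_of_real (emp_mean N y (pi_joint \<kappa> \<sigma> N y)) = of_real (a ^ CARD('k)) * (\<integral>t. f t * cnj (f t) \<partial>\<rho>)"
  proof -
    have 1: "complex_of_real (\<Prod>k\<in>UNIV. \<kappa> ((y m $ k - y n $ k) / \<sigma> k)) = of_real (a ^ CARD('k)) * (\<integral>t. e m t * cnj (e n t) \<partial>\<rho>)" for m n
    proof -
      have "complex_of_real (\<Prod>k\<in>UNIV. \<kappa> ((y m $ k - y n $ k) / \<sigma> k)) = of_real (a ^ CARD('k)) *
         (\<Prod>k\<in>UNIV. \<integral>s. cis (s * ((y m $ k - y n $ k) / \<sigma> k)) \<partial>\<nu>)"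
        by (simp add: kc prod.distrib)
      also have "(\<Prod>k\<in>UNIV. \<integral>s. cis (s * ((y m $ k - y n $ k) / \<sigma> k)) \<partial>\<nu>) =
         (\<integral>t. (\<Prod>k\<in>UNIV. cis (t k * ((y m $ k - y n $ k) / \<sigma> k))) \<partial>\<rho>)"
        by (rule prod) auto
      finally show ?thesis unfolding cis_diff prod.distrib e_def cnj_prod .
    qed
    have "complex_of_real (emp_mean N y (pi_joint \<kappa> \<sigma> N y)) =
        (1 / of_nat N) * (\<Sum>m=1..N. (1 / of_nat N) * (\<Sum>n=1..N. of_real (a ^ CARD('k)) * (\<integral>t. e m t * cnj (e n t) \<partial>\<rho>)))"
      unfolding emp_mean_def pi_joint_def 1[symmetric] by simp
    also have "\<dots> = of_real (a ^ CARD('k)) * (\<integral>t. (1 / of_nat N) * (\<Sum>m=1..N. (1 / of_nat N) * (\<Sum>n=1..N. e m t * cnj (e n t))) \<partial>\<rho>)"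
      by (simp add: int norm_mult sum_distrib_left mult.left_commute)
    also have "(\<lambda>t. (1 / of_nat N) * (\<Sum>m=1..N. (1 / of_nat N) * (\<Sum>n=1..N. e m t * cnj (e n t)))) = (\<lambda>t. f t * cnj (f t))"
      unfolding average_average_cnj f_def ecf_def e_def ..
    finally show ?thesis .
  qed
  \<comment> \<open>Each coordinate is averaged over its own pair of indices, so the integrals are
    one-dimensional until the product measure joins them.\<close>
  have product: "complex_of_real (\<Prod>k\<in>UNIV. emp_mean N y (\<lambda>z. pi_marginal \<kappa> \<sigma> N y k (z $ k))) = of_real (a ^ CARD('k)) * (\<integral>t. g t * cnj (g t) \<partial>\<rho>)"
  proof -
    have 1: "complex_of_real (emp_mean N y (\<lambda>z. pi_marginal \<kappa> \<sigma> N y k (z $ k))) = of_real a * (\<integral>s. ecf_marginal \<sigma> N y k s * cnj (ecf_marginal \<sigma> N y k s) \<partial>\<nu>)" for k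
    proof -
      have "complex_of_real (emp_mean N y (\<lambda>z. pi_marginal \<kappa> \<sigma> N y k (z $ k))) =
        (1 / of_nat N) * (\<Sum>m=1..N. (1 / of_nat N) * (\<Sum>n=1..N. of_real a * (\<integral>s. cis (s * ((y m $ k - y n $ k) / \<sigma> k)) \<partial>\<nu>)))"
        unfolding emp_mean_def pi_marginal_def kc[symmetric] by simp
      also have "\<dots> = of_real a * (\<integral>s. (1 / of_nat N) * (\<Sum>m=1..N. (1 / of_nat N) * (\<Sum>n=1..N. cis (s * ((y m $ k - y n $ k) / \<sigma> k)))) \<partial>\<nu>)"
        by (simp add: intc' sum_distrib_left mult.left_commute)
      also have "(\<lambda>s. (1 / of_nat N) * (\<Sum>m=1..N. (1 / of_nat N) * (\<Sum>n=1..N. cis (s * ((y m $ k - y n $ k) / \<sigma> k))))) =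
         (\<lambda>s. ecf_marginal \<sigma> N y k s * cnj (ecf_marginal \<sigma> N y k s))"
        unfolding cis_diff average_average_cnj ecf_marginal_def ..
      finally show ?thesis .
    qed
    have [measurable]: "ecf_marginal \<sigma> N y k \<in> borel_measurable borel" for k
      unfolding ecf_marginal_def by measurable
    have "complex_of_real (\<Prod>k\<in>UNIV. emp_mean N y (\<lambda>z. pi_marginal \<kappa> \<sigma> N y k (z $ k))) = of_real (a ^ CARD('k)) *
        (\<Prod>k\<in>UNIV. \<integral>s. ecf_marginal \<sigma> N y k s * cnj (ecf_marginal \<sigma> N y k s) \<partial>\<nu>)"
      by (simp add: 1 prod.distrib)
    also have "(\<Prod>k\<in>UNIV. \<integral>s. ecf_marginal \<sigma> N y k s * cnj (ecf_marginal \<sigma> N y k s) \<partial>\<nu>) = (\<integral>t. g t * cnj (g t) \<partial>\<rho>)"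
      by (subst prod) (auto simp: norm_mult g_def prod.distrib intro!: mult_le_one norm_ecf_marginal_le_1)
    finally show ?thesis .
  qed
  \<comment> \<open>All coordinates share the outer index \<open>m\<close>, which leaves the joint
    exponential \<open>e m\<close>, while the inner averages run separately and give
    \<open>g\<close>.\<close>
  have cross: "complex_of_real (emp_mean N y (\<lambda>z. \<Prod>k\<in>UNIV. pi_marginal \<kappa> \<sigma> N y k (z $ k))) = of_real (a ^ CARD('k)) * (\<integral>t. f t * cnj (g t) \<partial>\<rho>)"
  proof -
    have [measurable]: "ecf_marginal \<sigma> N y k \<in> borel_measurable borel" for k
      unfolding ecf_marginal_def by measurable
    have 1: "complex_of_real (pi_marginal \<kappa> \<sigma> N y k (y m $ k)) = of_real a * (\<integral>s. cis (s * (y m $ k / \<sigma> k)) * cnj (ecf_marginal \<sigma> N y k s) \<partial>\<nu>)" for m k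
    proof -
      have "complex_of_real (pi_marginal \<kappa> \<sigma> N y k (y m $ k)) =
        (1 / of_nat N) * (\<Sum>n=1..N. of_real a * (\<integral>s. cis (s * ((y m $ k - y n $ k) / \<sigma> k)) \<partial>\<nu>))"
        unfolding pi_marginal_def kc[symmetric] by simp
      also have "\<dots> = of_real a * (\<integral>s. (1 / of_nat N) * (\<Sum>n=1..N. cis (s * ((y m $ k - y n $ k) / \<sigma> k))) \<partial>\<nu>)"
        by (simp add: intc' sum_distrib_left mult.left_commute)
      also have "(\<lambda>s. (1 / of_nat N) * (\<Sum>n=1..N. cis (s * ((y m $ k - y n $ k) / \<sigma> k)))) =
         (\<lambda>s. cis (s * (y m $ k / \<sigma> k)) * cnj (ecf_marginal \<sigma> N y k s))"
        unfolding cis_diff by (simp add: ecf_marginal_def fun_eq_iff sum_distrib_left sum_distrib_right mult_ac)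
      finally show ?thesis .
    qed
    have 2: "complex_of_real (\<Prod>k\<in>UNIV. pi_marginal \<kappa> \<sigma> N y k (y m $ k)) = of_real (a ^ CARD('k)) * (\<integral>t. e m t * cnj (g t) \<partial>\<rho>)" for m
    proof -
      have "complex_of_real (\<Prod>k\<in>UNIV. pi_marginal \<kappa> \<sigma> N y k (y m $ k)) = of_real (a ^ CARD('k)) *
         (\<Prod>k\<in>UNIV. \<integral>s. cis (s * (y m $ k / \<sigma> k)) * cnj (ecf_marginal \<sigma> N y k s) \<partial>\<nu>)"
        by (simp add: 1 prod.distrib)
      also have "(\<Prod>k\<in>UNIV. \<integral>s. cis (s * (y m $ k / \<sigma> k)) * cnj (ecf_marginal \<sigma> N y k s) \<partial>\<nu>) = (\<integral>t. e m t * cnj (g t) \<partial>\<rho>)"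
        by (subst prod) (auto simp: norm_mult g_def e_def prod.distrib intro!: norm_ecf_marginal_le_1)
      finally show ?thesis .
    qed
    have "complex_of_real (emp_mean N y (\<lambda>z. \<Prod>k\<in>UNIV. pi_marginal \<kappa> \<sigma> N y k (z $ k))) =
        (1 / of_nat N) * (\<Sum>m=1..N. of_real (a ^ CARD('k)) * (\<integral>t. e m t * cnj (g t) \<partial>\<rho>))"
      unfolding emp_mean_def 2[symmetric] by simp
    also have "\<dots> = of_real (a ^ CARD('k)) * (\<integral>t. (1 / of_nat N) * (\<Sum>m=1..N. e m t * cnj (g t)) \<partial>\<rho>)"
      by (simp add: int norm_mult ng sum_distrib_left mult.left_commute)
    also have "(\<lambda>t. (1 / of_nat N) * (\<Sum>m=1..N. e m t * cnj (g t))) = (\<lambda>t. f t * cnj (g t))"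
      by (simp add: f_def ecf_def e_def fun_eq_iff sum_distrib_left sum_distrib_right mult_ac)
    finally show ?thesis .
  qed
  have "complex_of_real (2 * Q_hat \<kappa> \<sigma> N y) = of_real (a ^ CARD('k)) *
      ((\<integral>t. f t * cnj (f t) \<partial>\<rho>) + (\<integral>t. g t * cnj (g t) \<partial>\<rho>) - 2 * (\<integral>t. f t * cnj (g t) \<partial>\<rho>))"
    using joint product cross by (simp add: Q_hat_def algebra_simps)
  also have "\<dots> = of_real (a ^ CARD('k)) * (\<integral>t. f t * cnj (f t) + g t * cnj (g t) - 2 * (f t * cnj (g t)) \<partial>\<rho>)"
    by (simp add: int norm_mult nf ng mult_le_one)
  \<comment> \<open>The cross integrand need not be real, but the left side is; taking real parts
    turns the integrand into \<open>(norm (f t - g t))\<^sup>2\<close>.\<close>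
  finally have "2 * Q_hat \<kappa> \<sigma> N y = Re (of_real (a ^ CARD('k)) * (\<integral>t. f t * cnj (f t) + g t * cnj (g t) - 2 * (f t * cnj (g t)) \<partial>\<rho>))"
    by (metis Re_complex_of_real)
  also have "\<dots> = a ^ CARD('k) * Re (\<integral>t. f t * cnj (f t) + g t * cnj (g t) - 2 * (f t * cnj (g t)) \<partial>\<rho>)"
    by simp
  also have "Re (\<integral>t. f t * cnj (f t) + g t * cnj (g t) - 2 * (f t * cnj (g t)) \<partial>\<rho>) =
     (\<integral>t. Re (f t * cnj (f t) + g t * cnj (g t) - 2 * (f t * cnj (g t))) \<partial>\<rho>)"
    by (intro integral_Re[symmetric] Bochner_Integration.integrable_add Bochner_Integration.integrable_diff
        integrable_mult_right int) (auto simp: norm_mult nf ng mult_le_one)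
  also have "\<dots> = (\<integral>t. (norm (f t - g t))\<^sup>2 \<partial>\<rho>)"
    by (intro Bochner_Integration.integral_cong refl, simp add: cmod_power2)
       (simp add: power2_eq_square algebra_simps)
  finally show ?thesis by (simp add: f_def g_def \<rho>_def)
qed

section \<open>The limit\<close>

lemma borel_measurable_vec_nth [measurable]: "(\<lambda>v :: real ^ 'k. v $ k) \<in> borel_measurable borel"
  by (intro borel_measurable_continuous_onI continuous_intros)

section \<open>Characteristic functions of the true law and their factorisation gap\<close>

definition cf :: "('k::finite \<Rightarrow> real) \<Rightarrow> (real ^ 'k) measure \<Rightarrow> ('k \<Rightarrow> real) \<Rightarrow> complex" where
  "cf \<sigma> D t = (\<integral>v. (\<Prod>k\<in>UNIV. cis (t k * (v $ k / \<sigma> k))) \<partial>D)"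

definition cf_marginal :: "('k::finite \<Rightarrow> real) \<Rightarrow> (real ^ 'k) measure \<Rightarrow> 'k \<Rightarrow> real \<Rightarrow> complex" where
  "cf_marginal \<sigma> D k s = (\<integral>v. cis (s * (v $ k / \<sigma> k)) \<partial>D)"

definition cf_gap :: "('k::finite \<Rightarrow> real) \<Rightarrow> (real ^ 'k) measure \<Rightarrow> ('k \<Rightarrow> real) \<Rightarrow> real" where
  "cf_gap \<sigma> D t = (norm (cf \<sigma> D t - (\<Prod>k\<in>UNIV. cf_marginal \<sigma> D k (t k))))\<^sup>2"

lemma cf_gap_nonneg: "0 \<le> cf_gap \<sigma> D t"
  by (simp add: cf_gap_def)

lemma cf_gap_le_4:
  fixes D :: "(real ^ 'k::finite) measure"
  assumes "prob_space D" and [measurable_cong]: "sets D = sets borel"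
  shows "cf_gap \<sigma> D t \<le> 4"
proof -
  interpret D: prob_space D by fact
  have le1: "norm (\<integral>v. f v \<partial>D) \<le> 1" if "f \<in> borel_measurable D" "\<And>v. norm (f v) = 1" for f :: "real ^ 'k \<Rightarrow> complex"
    using integral_norm_bound[of D f] by (simp add: that D.prob_space)
  have "norm (cf \<sigma> D t) \<le> 1"
    unfolding cf_def by (rule le1) (auto simp flip: prod_norm)
  moreover have "norm (\<Prod>k\<in>UNIV. cf_marginal \<sigma> D k (t k)) \<le> 1"
    unfolding cf_marginal_def by (auto simp flip: prod_norm intro!: prod_le_1 le1)
  ultimately have "norm (cf \<sigma> D t - (\<Prod>k\<in>UNIV. cf_marginal \<sigma> D k (t k))) \<le> 2"
    by (intro order_trans[OF norm_triangle_ineq4]) linarith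
  then have "cf_gap \<sigma> D t \<le> 2\<^sup>2" unfolding cf_gap_def by (intro power_mono) auto
  then show ?thesis by simp
qed

text \<open>Continuity in sequential, coordinatewise form, which is how points outside a null set
  will approach a given one. The exponentials have norm 1, so dominated convergence applies.\<close>

lemma cf_gap_tendsto:
  fixes D :: "(real ^ 'k::finite) measure"
  assumes "prob_space D" and [measurable_cong]: "sets D = sets borel"
    and s: "\<And>k. (\<lambda>m. s m k) \<longlonglongrightarrow> t k"
  shows "(\<lambda>m. cf_gap \<sigma> D (s m)) \<longlonglongrightarrow> cf_gap \<sigma> D t"
proof -
  interpret D: prob_space D by fact
  have cis_lim: "(\<lambda>m. cis (s m k * x)) \<longlonglongrightarrow> cis (t k * x)" for k x
    by (intro tendsto_intros s)
  have "(\<lambda>m. cf \<sigma> D (s m)) \<longlonglongrightarrow> cf \<sigma> D t"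
    unfolding cf_def
  proof (rule integral_dominated_convergence[where w="\<lambda>_. 1"])
    show "AE v in D. (\<lambda>m. \<Prod>k\<in>UNIV. cis (s m k * (v $ k / \<sigma> k))) \<longlonglongrightarrow> (\<Prod>k\<in>UNIV. cis (t k * (v $ k / \<sigma> k)))"
      by (intro AE_I2 tendsto_prod cis_lim)
  qed (auto simp flip: prod_norm)
  moreover have "(\<lambda>m. cf_marginal \<sigma> D k (s m k)) \<longlonglongrightarrow> cf_marginal \<sigma> D k (t k)" for k
    unfolding cf_marginal_def
  proof (rule integral_dominated_convergence[where w="\<lambda>_. 1"])
    show "AE v in D. (\<lambda>m. cis (s m k * (v $ k / \<sigma> k))) \<longlonglongrightarrow> cis (t k * (v $ k / \<sigma> k))"
      by (intro AE_I2 cis_lim)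
  qed auto
  ultimately show ?thesis
    unfolding cf_gap_def by (intro tendsto_intros)
qed

lemma cf_gap_measurable [measurable]:
  fixes D :: "(real ^ 'k::finite) measure"
  assumes "prob_space D" and [measurable_cong]: "sets D = sets borel" "sets \<nu> = sets borel"
  shows "cf_gap \<sigma> D \<in> borel_measurable (PiM UNIV (\<lambda>_. \<nu>))"
proof -
  interpret D: prob_space D by fact
  show ?thesis unfolding cf_gap_def cf_def cf_marginal_def by measurable
qed

text \<open>Every box has positive mass, so a null set of \<open>t\<close> is avoided by a sequence tending to
  any given point.\<close>

lemma cf_gap_eq_0_of_AE:
  fixes D :: "(real ^ 'k::finite) measure"
  assumes D: "prob_space D" "sets D = sets borel" and "real_distribution \<nu>"
    and pos: "\<And>a b. a < b \<Longrightarrow> 0 < measure \<nu> {a<..<b}"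
    and AE: "AE t in PiM UNIV (\<lambda>_. \<nu>). cf_gap \<sigma> D t = 0"
  shows "cf_gap \<sigma> D t = 0"
proof -
  interpret \<nu>: real_distribution \<nu> by fact
  interpret Pi: product_prob_space "\<lambda>_::'k. \<nu>" UNIV by unfold_locales
  define r where "r m = inverse (real (Suc m))" for m
  have r: "r m > 0" for m by (simp add: r_def)
  have "\<exists>s. (\<forall>k. s k \<in> {t k - r m<..<t k + r m}) \<and> cf_gap \<sigma> D s = 0" for m
  proof (rule ccontr)
    define B where "B = PiE UNIV (\<lambda>k. {t k - r m<..<t k + r m})"
    assume "\<not> ?thesis"
    with AE have "AE s in PiM UNIV (\<lambda>_. \<nu>). s \<notin> B"
      by (auto simp: B_def PiE_iff Ball_def elim!: eventually_mono)
    moreover have "B \<in> sets (PiM UNIV (\<lambda>_. \<nu>))" unfolding B_def by (intro sets_PiM_I_finite) auto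
    ultimately have "emeasure (PiM UNIV (\<lambda>_. \<nu>)) B = 0" by (simp add: AE_iff_null_sets[symmetric] null_setsD1)
    moreover have "emeasure (PiM UNIV (\<lambda>_. \<nu>)) B = (\<Prod>k\<in>UNIV. emeasure \<nu> {t k - r m<..<t k + r m})"
      unfolding B_def by (intro Pi.emeasure_PiM) auto
    moreover have "emeasure \<nu> {t k - r m<..<t k + r m} \<noteq> 0" for k
      using pos[of "t k - r m" "t k + r m"] r[of m] by (simp add: \<nu>.emeasure_eq_measure)
    ultimately show False by (simp add: prod_zero_iff)
  qed
  then obtain s where s: "\<And>m k. s m k \<in> {t k - r m<..<t k + r m}" and 0: "\<And>m. cf_gap \<sigma> D (s m) = 0"
    by metis
  have "(\<lambda>m. s m k) \<longlonglongrightarrow> t k" for k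
  proof (rule tendsto_sandwich)
    show "(\<lambda>m. t k - r m) \<longlonglongrightarrow> t k"
      unfolding r_def using tendsto_diff[OF tendsto_const LIMSEQ_inverse_real_of_nat] by simp
    show "(\<lambda>m. t k + r m) \<longlonglongrightarrow> t k"
      unfolding r_def using tendsto_add[OF tendsto_const LIMSEQ_inverse_real_of_nat] by simp
  qed (use s in \<open>auto intro!: always_eventually less_imp_le\<close>)
  then have "(\<lambda>m. cf_gap \<sigma> D (s m)) \<longlonglongrightarrow> cf_gap \<sigma> D t"
    by (rule cf_gap_tendsto[OF D])
  then show ?thesis by (simp add: 0 LIMSEQ_const_iff)
qed

lemma (in prob_space) indep_vars_of_cf_gap_eq_0:
  fixes Y :: "'a \<Rightarrow> real ^ 'k::finite"
  assumes Y [measurable]: "Y \<in> borel_measurable M" and \<sigma>: "\<And>k. 0 < \<sigma> k"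
    and gap: "\<And>t. cf_gap \<sigma> (distr M borel Y) t = 0"
  shows "indep_vars (\<lambda>_. borel) (\<lambda>k x. Y x $ k) UNIV"
proof (rule indep_vars_of_char)
  fix t :: "'k \<Rightarrow> real"
  \<comment> \<open>The frequencies \<open>t k * \<sigma> k\<close> undo the scaling built into
    \<open>cf\<close>.\<close>
  have eq: "(t k * \<sigma> k) * (v / \<sigma> k) = t k * v" for k v using \<sigma>[of k] by simp
  have "cf \<sigma> (distr M borel Y) (\<lambda>k. t k * \<sigma> k) = (\<Prod>k\<in>UNIV. cf_marginal \<sigma> (distr M borel Y) k (t k * \<sigma> k))"
    using gap[of "\<lambda>k. t k * \<sigma> k"] by (simp add: cf_gap_def)
  then show "expectation (\<lambda>x. \<Prod>k\<in>UNIV. cis (t k * Y x $ k)) = (\<Prod>k\<in>UNIV. expectation (\<lambda>x. cis (t k * Y x $ k)))"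
    unfolding cf_def cf_marginal_def eq by (simp add: integral_distr)
qed measurable

section \<open>Almost sure convergence of the estimator\<close>

lemma (in prob_space) AE_ecf_gap_tendsto:
  fixes Ys :: "nat \<Rightarrow> 'a \<Rightarrow> real ^ 'k::finite"
  assumes indep: "indep_vars (\<lambda>_. borel) Ys {1..}"
    and law: "\<And>n. 1 \<le> n \<Longrightarrow> distr M borel (Ys n) = D"
  shows "AE x in M. (\<lambda>N. (norm (ecf \<sigma> N (\<lambda>n. Ys n x) t - (\<Prod>k\<in>UNIV. ecf_marginal \<sigma> N (\<lambda>n. Ys n x) k (t k))))\<^sup>2)
    \<longlonglongrightarrow> cf_gap \<sigma> D t"
proof -
  have "AE x in M. (\<lambda>N. ecf \<sigma> N (\<lambda>n. Ys n x) t) \<longlonglongrightarrow> cf \<sigma> D t"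
    unfolding ecf_def cf_def
    by (rule strong_law_bounded_complex[OF indep _ _ law, of _ 1]) (auto simp flip: prod_norm)
  moreover have "AE x in M. \<forall>k\<in>UNIV. (\<lambda>N. ecf_marginal \<sigma> N (\<lambda>n. Ys n x) k (t k)) \<longlonglongrightarrow> cf_marginal \<sigma> D k (t k)"
    unfolding ecf_marginal_def cf_marginal_def
    by (intro AE_finite_allI finite strong_law_bounded_complex[OF indep _ _ law, of _ 1]) auto
  ultimately show ?thesis
  proof eventually_elim
    case (elim x)
    then show ?case unfolding cf_gap_def by (intro tendsto_intros) auto
  qed
qed

theorem (in prob_space) AE_Q_hat_tendsto:
  fixes Ys :: "nat \<Rightarrow> 'a \<Rightarrow> real ^ 'k::finite"
  assumes indep: "indep_vars (\<lambda>_. borel) Ys {1..}"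
    and law: "\<And>n. 1 \<le> n \<Longrightarrow> distr M borel (Ys n) = D"
    and \<nu>: "real_distribution \<nu>" and kernel: "\<And>x. complex_of_real (\<kappa> x) = of_real a * char \<nu> x"
  shows "AE x in M. (\<lambda>N. Q_hat \<kappa> \<sigma> N (\<lambda>n. Ys n x)) \<longlonglongrightarrow>
    a ^ CARD('k) / 2 * (\<integral>t. cf_gap \<sigma> D t \<partial>PiM UNIV (\<lambda>_. \<nu>))"
proof -
  interpret \<nu>: real_distribution \<nu> by fact
  interpret Pi: product_prob_space "\<lambda>_::'k. \<nu>" UNIV by unfold_locales
  define \<rho> where "\<rho> = PiM UNIV (\<lambda>_::'k. \<nu>)"
  interpret \<rho>: prob_space \<rho> unfolding \<rho>_def by (intro prob_space_PiM) unfold_locales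
  interpret pair: pair_sigma_finite M \<rho> by unfold_locales
  have rv: "Ys n \<in> borel_measurable M" if "1 \<le> n" for n
    using indep that by (auto simp: indep_vars_def)
  have D: "prob_space D" "sets D = sets borel"
    using law[of 1] prob_space_distr[OF rv[of 1]] by auto
  define F where "F N x t = (norm (ecf \<sigma> N (\<lambda>n. Ys n x) t - (\<Prod>k\<in>UNIV. ecf_marginal \<sigma> N (\<lambda>n. Ys n x) k (t k))))\<^sup>2" for N x t
  have Q: "Q_hat \<kappa> \<sigma> N y = a ^ CARD('k) / 2 *
      (\<integral>t. (norm (ecf \<sigma> N y t - (\<Prod>k\<in>UNIV. ecf_marginal \<sigma> N y k (t k))))\<^sup>2 \<partial>\<rho>)" for N y
    unfolding \<rho>_def by (rule Q_hat_eq_integral[OF \<nu> kernel])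
  \<comment> \<open>Two points of the unit disc are at most 2 apart; the constant is integrable
    because \<open>\<rho>\<close> is a probability.\<close>
  have F_le: "F N x t \<le> 4" for N x t
  proof -
    have "norm (ecf \<sigma> N (\<lambda>n. Ys n x) t - (\<Prod>k\<in>UNIV. ecf_marginal \<sigma> N (\<lambda>n. Ys n x) k (t k))) \<le> 2"
      using norm_ecf_le_1[of \<sigma> N "\<lambda>n. Ys n x" t] norm_prod_ecf_marginal_le_1[of \<sigma> N "\<lambda>n. Ys n x" t]
      by (intro order_trans[OF norm_triangle_ineq4]) linarith
    then have "F N x t \<le> 2\<^sup>2" unfolding F_def by (intro power_mono) auto
    then show ?thesis by simp
  qed
  have F_meas: "F N x \<in> borel_measurable \<rho>" for N x
    unfolding F_def \<rho>_def
    by (intro borel_measurable_power borel_measurable_norm borel_measurable_diff ecf_measurable) simp_all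
  have gap [measurable]: "cf_gap \<sigma> D \<in> borel_measurable \<rho>"
    unfolding \<rho>_def by (rule cf_gap_measurable[OF D]) simp
  have joint [measurable]: "(\<lambda>p. F N (fst p) (snd p)) \<in> borel_measurable (M \<Otimes>\<^sub>M \<rho>)" for N
  proof -
    \<comment> \<open>Measurability of \<open>Ys n\<close> is known from index 1 on, hence the
      restriction to the range of the sum.\<close>
    have c [measurable]: "(\<lambda>p. cis (snd p k * (Ys n (fst p) $ k / \<sigma> k))) \<in> borel_measurable (M \<Otimes>\<^sub>M \<rho>)" if "n \<in> {1..N}" for n k
    proof -
      have [measurable]: "Ys n \<in> borel_measurable M" using rv that by simp
      show ?thesis unfolding \<rho>_def by measurable
    qed
    have [measurable]: "(\<lambda>p. ecf \<sigma> N (\<lambda>n. Ys n (fst p)) (snd p)) \<in> borel_measurable (M \<Otimes>\<^sub>M \<rho>)"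
      unfolding ecf_def
      by (intro borel_measurable_times borel_measurable_sum borel_measurable_prod borel_measurable_const c)
    have [measurable]: "(\<lambda>p. \<Prod>k\<in>UNIV. ecf_marginal \<sigma> N (\<lambda>n. Ys n (fst p)) k (snd p k)) \<in> borel_measurable (M \<Otimes>\<^sub>M \<rho>)"
      unfolding ecf_marginal_def
      by (intro borel_measurable_times borel_measurable_sum borel_measurable_prod borel_measurable_const c)
    show ?thesis unfolding F_def by measurable
  qed
  have "AE t in \<rho>. AE x in M. (\<lambda>N. F N x t) \<longlonglongrightarrow> cf_gap \<sigma> D t"
    unfolding F_def by (intro AE_I2 AE_ecf_gap_tendsto[OF indep law])
  \<comment> \<open>Exchanging the null sets requires a measurable set of convergence; written with
    countable quantifiers over tolerances and indices, it visibly is one.\<close>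
  moreover have "{p \<in> space (M \<Otimes>\<^sub>M \<rho>). (\<lambda>N. F N (fst p) (snd p)) \<longlonglongrightarrow> cf_gap \<sigma> D (snd p)} \<in> sets (M \<Otimes>\<^sub>M \<rho>)"
    unfolding LIMSEQ_iff_countable by measurable
  ultimately have "AE x in M. AE t in \<rho>. (\<lambda>N. F N x t) \<longlonglongrightarrow> cf_gap \<sigma> D t"
    using pair.AE_commute[of "\<lambda>x t. (\<lambda>N. F N x t) \<longlonglongrightarrow> cf_gap \<sigma> D t"] by blast
  then show ?thesis
  proof eventually_elim
    case (elim x)
    have "(\<lambda>N. \<integral>t. F N x t \<partial>\<rho>) \<longlonglongrightarrow> (\<integral>t. cf_gap \<sigma> D t \<partial>\<rho>)"
    proof (rule integral_dominated_convergence[where w="\<lambda>_. 4"])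
      show "AE t in \<rho>. norm (F N x t) \<le> 4" for N
        using F_le by (auto simp: F_def intro!: AE_I2)
    qed (use elim F_meas in auto)
    then show ?case unfolding Q F_def \<rho>_def[symmetric] by (rule tendsto_mult_left)
  qed
qed

text \<open>\<open>Y\<close> and the sample may live on different probability spaces and share only
  the law. Convergence is asserted along with positivity, because \<open>lim\<close> of a divergent
  sequence carries no information.\<close>

theorem lemma3p1:
  fixes K :: "real \<Rightarrow> real" and \<Psi> :: "real \<Rightarrow> real"
    and h :: real and \<sigma> :: "'k::finite \<Rightarrow> real"
    and P :: "'b measure" and Y :: "'b \<Rightarrow> real ^ 'k"
    and M :: "'a measure" and Ys :: "nat \<Rightarrow> 'a \<Rightarrow> real ^ 'k"
  assumes "square_summable K"
    and "is_fourier_transform (\<lambda>u. complex_of_real (autocorr K u)) (\<lambda>t. complex_of_real (\<Psi> t))"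
    and "AE t in lebesgue. 0 \<le> \<Psi> t"
    and "AE t in lebesgue. \<Psi> t \<noteq> 0"
    and "0 < h"
    and "\<And>k. 0 < \<sigma> k"
    and "prob_space P"
    and "Y \<in> borel_measurable P"
    and "\<not> prob_space.indep_vars P (\<lambda>_. borel) (\<lambda>k \<omega>. Y \<omega> $ k) UNIV"
    and "prob_space M"
    and "prob_space.indep_vars M (\<lambda>_. borel) Ys {1..}"
    and "\<And>n. 1 \<le> n \<Longrightarrow> distr M borel (Ys n) = distr P borel Y"
  shows "AE \<omega> in M.
           convergent (\<lambda>N. Q_hat (rescale h (autocorr K)) \<sigma> N (\<lambda>n. Ys n \<omega>)) \<and>
           0 < lim (\<lambda>N. Q_hat (rescale h (autocorr K)) \<sigma> N (\<lambda>n. Ys n \<omega>))"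
proof -
  interpret P: prob_space P by fact
  interpret M: prob_space M by fact
  note [measurable] = \<open>Y \<in> borel_measurable P\<close>
  obtain \<nu>0 c where \<nu>0: "real_distribution \<nu>0" and c: "0 < c"
    and inv: "\<And>u. complex_of_real (autocorr K u) = of_real c * char \<nu>0 u"
    and pos0: "\<And>a b. a < b \<Longrightarrow> 0 < measure \<nu>0 {a<..<b}"
    using autocorr_eq_char[OF assms(1-4)] by blast
  interpret \<nu>0: real_distribution \<nu>0 by fact
  \<comment> \<open>The bandwidth moves into the frequencies: dividing them by \<open>h\<close>
    yields the characteristic function at \<open>x / h\<close>, and the factor \<open>1 / h\<close>
    of \<open>rescale\<close> goes into \<open>a\<close>.\<close>
  define \<nu> where "\<nu> = distr \<nu>0 borel (\<lambda>t. t / h)"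
  have \<nu>: "real_distribution \<nu>"
    unfolding \<nu>_def by (rule \<nu>0.real_distribution_distr) simp
  interpret \<nu>: real_distribution \<nu> by (rule \<nu>)
  define a where "a = c / h"
  have a: "a > 0" using c \<open>0 < h\<close> by (simp add: a_def)
  have kernel: "complex_of_real (rescale h (autocorr K) x) = of_real a * char \<nu> x" for x
  proof -
    have "char \<nu> x = char \<nu>0 (x / h)"
      unfolding char_def \<nu>_def by (subst integral_distr) auto
    then show ?thesis by (simp add: rescale_def a_def inv)
  qed
  have pos: "0 < measure \<nu> {u<..<v}" if "u < v" for u v
  proof -
    have "measure \<nu> {u<..<v} = measure \<nu>0 ((\<lambda>t. t / h) -` {u<..<v} \<inter> space \<nu>0)"
      unfolding \<nu>_def by (rule measure_distr) auto
    also have "(\<lambda>t. t / h) -` {u<..<v} \<inter> space \<nu>0 = {u * h<..<v * h}"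
      using \<open>0 < h\<close> by (auto simp: field_simps)
    finally show ?thesis using pos0[of "u * h" "v * h"] that \<open>0 < h\<close> by simp
  qed
  define D where "D = distr P borel Y"
  have D: "prob_space D" "sets D = sets borel"
    by (auto simp: D_def intro: P.prob_space_distr)
  define L where "L = a ^ CARD('k) / 2 * (\<integral>t. cf_gap \<sigma> D t \<partial>PiM UNIV (\<lambda>_. \<nu>))"
  interpret Pi: prob_space "PiM UNIV (\<lambda>_::'k. \<nu>)" by (intro prob_space_PiM) unfold_locales
  have int: "integrable (PiM UNIV (\<lambda>_. \<nu>)) (cf_gap \<sigma> D)"
    by (rule Pi.integrable_const_bound[of _ 4])
       (auto intro!: AE_I2 cf_gap_measurable[OF D] cf_gap_le_4[OF D] simp: cf_gap_nonneg)
  have "(\<integral>t. cf_gap \<sigma> D t \<partial>PiM UNIV (\<lambda>_. \<nu>)) \<noteq> 0"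
  proof
    assume "(\<integral>t. cf_gap \<sigma> D t \<partial>PiM UNIV (\<lambda>_. \<nu>)) = 0"
    then have "AE t in PiM UNIV (\<lambda>_. \<nu>). cf_gap \<sigma> D t = 0"
      by (subst (asm) integral_nonneg_eq_0_iff_AE[OF int]) (auto simp: cf_gap_nonneg)
    then have "cf_gap \<sigma> D t = 0" for t
      using pos by (intro cf_gap_eq_0_of_AE[OF D \<nu>]) auto
    then show False
      using P.indep_vars_of_cf_gap_eq_0[of Y \<sigma>] assms(6,9) by (simp add: D_def)
  qed
  moreover have "(\<integral>t. cf_gap \<sigma> D t \<partial>PiM UNIV (\<lambda>_. \<nu>)) \<ge> 0"
    by (simp add: cf_gap_nonneg)
  ultimately have "L > 0" using a by (simp add: L_def)
  have "AE \<omega> in M. (\<lambda>N. Q_hat (rescale h (autocorr K)) \<sigma> N (\<lambda>n. Ys n \<omega>)) \<longlonglongrightarrow> L"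
    unfolding L_def
    by (rule M.AE_Q_hat_tendsto[OF assms(11) _ \<nu> kernel]) (simp add: D_def assms(12))
  then show ?thesis
    by eventually_elim (use \<open>L > 0\<close> in \<open>auto simp: limI convergentI\<close>)
qed

end
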